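(* (Fully continuous limit of C3: generalized Schwarzian Boussinesq equation, by formal expansion.) Consider the semi-discrete three-point equation for functions $u_\nu(x)$, $\nu\in\{-1,0,1\}$ (primes are derivatives with respect to $x$): $$\partial_x\log\left[P(p)(u_1-u_{-1})-b_1-b_0u_{-1}+\frac{u_1'u_0'u_{-1}'}{(u_1-u_0)(u_0-u_{-1})}\right]=\frac{u_1'}{u_1-u_0}-\frac{u_{-1}'}{u_0-u_{-1}},$$ where $P(p)=g_3(p)$ or $P(p)=g_3(p)-g_3(a)$ with $g_3(s)=s^3+\alpha_2s^2+\alpha_1s+\alpha_0$. Put $p=1/\delta$ and $u_\nu=v(y+\nu\delta,x)$, make the additional change of variables defined by $$\partial_y=(1-\tfrac13\alpha_2\delta)\partial_x+\tfrac12\delta\,\partial_t,$$ and expand formally in $\delta\to0$. Then at leading order one obtains $$3\,\partial_t\left(\frac{v_t}{v_x}\right)+\partial_x\left(\frac{v_{xxx}}{v_x}+\frac32\,\frac{v_t^2-v_{xx}^2}{v_x^2}-4\,\frac{b_1+b_0v}{v_x}\right)=0.$$ If $b_0=b_1=0$ this is the Schwarzian Boussinesq equation; the additional $b_0,b_1$ terms break the Möbius invariance.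
   Context: The three-point equation is the straight semi-continuous limit of the one-component ($3\times3$ stencil) form of the C3 lattice Boussinesq system; $p$ is the lattice parameter of the remaining discrete direction, and $a,b_0,b_1,\alpha_0,\alpha_1,\alpha_2$ are constants. The derivation is a formal expansion in $\delta$. *)

theory Defs
  imports "HOL-Analysis.Analysis"
begin

text \<open>
  Everything is stated over a type \<open>'a\<close> of class \<open>real_normed_field\<close>, so that real-valued
  functions of real variables and holomorphic functions of complex variables are both covered.
\<close>

definition pdx :: "('a::real_normed_field \<Rightarrow> 'a \<Rightarrow> 'a) \<Rightarrow> 'a \<Rightarrow> 'a \<Rightarrow> 'a" where
  "pdx f x t = deriv (\<lambda>s. f s t) x"

definition pdt :: "('a::real_normed_field \<Rightarrow> 'a \<Rightarrow> 'a) \<Rightarrow> 'a \<Rightarrow> 'a \<Rightarrow> 'a" where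
  "pdt f x t = deriv (\<lambda>s. f x s) t"

inductive_set iterated_partials ::
  "('a::real_normed_field \<Rightarrow> 'a \<Rightarrow> 'a) \<Rightarrow> ('a \<Rightarrow> 'a \<Rightarrow> 'a) set"
  for f :: "'a \<Rightarrow> 'a \<Rightarrow> 'a"
where
  base: "f \<in> iterated_partials f"
| pdx: "g \<in> iterated_partials f \<Longrightarrow> pdx g \<in> iterated_partials f"
| pdt: "g \<in> iterated_partials f \<Longrightarrow> pdt g \<in> iterated_partials f"

definition smooth_on2 ::
  "('a::real_normed_field \<times> 'a) set \<Rightarrow> ('a \<Rightarrow> 'a \<Rightarrow> 'a) \<Rightarrow> bool" where
  "smooth_on2 U f \<longleftrightarrow> (\<forall>g\<in>iterated_partials f.
     continuous_on U (\<lambda>(x, t). g x t) \<and>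
     (\<forall>(x, t)\<in>U. (\<lambda>s. g s t) field_differentiable (at x) \<and>
                 (\<lambda>s. g x s) field_differentiable (at t)))"

definition g3 :: "'a::real_normed_field \<Rightarrow> 'a \<Rightarrow> 'a \<Rightarrow> 'a \<Rightarrow> 'a" where
  "g3 \<alpha>0 \<alpha>1 \<alpha>2 s = s ^ 3 + \<alpha>2 * s ^ 2 + \<alpha>1 * s + \<alpha>0"

text \<open>
  The branch-independent reading of \<open>\<partial>\<^sub>x log f\<close>; it also makes sense where a real \<open>f\<close> is
  negative.
\<close>

definition dlog :: "('a::real_normed_field \<Rightarrow> 'a) \<Rightarrow> 'a \<Rightarrow> 'a" where
  "dlog f x = deriv f x / f x"

text \<open>The argument \<open>c\<close> is the value \<open>P(p)\<close>; \<open>u \<nu>\<close> is used for \<open>\<nu> \<in> {-1, 0, 1}\<close> only.\<close>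

definition three_point_lhs ::
  "'a::real_normed_field \<Rightarrow> 'a \<Rightarrow> 'a \<Rightarrow> (int \<Rightarrow> 'a \<Rightarrow> 'a) \<Rightarrow> 'a \<Rightarrow> 'a" where
  "three_point_lhs c b0 b1 u =
     dlog (\<lambda>x. c * (u 1 x - u (-1) x) - b1 - b0 * u (-1) x
                 + deriv (u 1) x * deriv (u 0) x * deriv (u (-1)) x
                     / ((u 1 x - u 0 x) * (u 0 x - u (-1) x)))"

definition three_point_rhs :: "(int \<Rightarrow> 'a::real_normed_field \<Rightarrow> 'a) \<Rightarrow> 'a \<Rightarrow> 'a" where
  "three_point_rhs u x =
     deriv (u 1) x / (u 1 x - u 0 x) - deriv (u (-1)) x / (u 0 x - u (-1) x)"

text \<open>
  The old coordinates are \<open>(y, x)\<close>, the new ones \<open>(new_x, new_t)\<close>.  A function \<open>v\<close> of the new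
  coordinates is pulled back to the old ones by \<open>in_old_coords\<close>; thus
  \<open>\<partial>\<^sub>y = (1 - \<alpha>2 \<delta> / 3) \<partial>\<^sub>x + (\<delta> / 2) \<partial>\<^sub>t\<close>, while \<open>\<partial>\<^sub>x\<close> is unchanged.
\<close>

definition new_x :: "'a::real_normed_field \<Rightarrow> 'a \<Rightarrow> 'a \<Rightarrow> 'a \<Rightarrow> 'a" where
  "new_x \<alpha>2 \<delta> y x = x + (1 - \<alpha>2 * \<delta> / 3) * y"

definition new_t :: "'a::real_normed_field \<Rightarrow> 'a \<Rightarrow> 'a" where
  "new_t \<delta> y = \<delta> / 2 * y"

definition in_old_coords ::
  "'a::real_normed_field \<Rightarrow> 'a \<Rightarrow> ('a \<Rightarrow> 'a \<Rightarrow> 'a) \<Rightarrow> 'a \<Rightarrow> 'a \<Rightarrow> 'a" where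
  "in_old_coords \<alpha>2 \<delta> v y x = v (new_x \<alpha>2 \<delta> y x) (new_t \<delta> y)"

lemma in_old_coords_deriv_y:
  fixes v :: "'a::real_normed_field \<Rightarrow> 'a \<Rightarrow> 'a"
  assumes "((\<lambda>(x, t). v x t) has_derivative (\<lambda>(h, k). vx * h + vt * k))
             (at (new_x \<alpha>2 \<delta> y x, new_t \<delta> y))"
  shows "((\<lambda>y. in_old_coords \<alpha>2 \<delta> v y x) has_field_derivative
            (1 - \<alpha>2 * \<delta> / 3) * vx + \<delta> / 2 * vt) (at y)"
proof -
  have c: "((\<lambda>y. (new_x \<alpha>2 \<delta> y x, new_t \<delta> y)) has_derivative
              (\<lambda>h. ((1 - \<alpha>2 * \<delta> / 3) * h, \<delta> / 2 * h))) (at y)"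
    unfolding new_x_def new_t_def by (auto intro!: derivative_eq_intros)
  have "(\<lambda>h. vx * ((1 - \<alpha>2 * \<delta> / 3) * h) + vt * (\<delta> / 2 * h))
        = (*) ((1 - \<alpha>2 * \<delta> / 3) * vx + \<delta> / 2 * vt)"
    by (simp add: fun_eq_iff algebra_simps)
  then show ?thesis
    using has_derivative_compose[OF c assms]
    by (simp only: in_old_coords_def has_field_derivative_def prod.case)
qed

lemma in_old_coords_deriv_x:
  fixes v :: "'a::real_normed_field \<Rightarrow> 'a \<Rightarrow> 'a"
  assumes "((\<lambda>(x, t). v x t) has_derivative (\<lambda>(h, k). vx * h + vt * k))
             (at (new_x \<alpha>2 \<delta> y x, new_t \<delta> y))"
  shows "((\<lambda>x. in_old_coords \<alpha>2 \<delta> v y x) has_field_derivative vx) (at x)"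
proof -
  have c: "((\<lambda>x. (new_x \<alpha>2 \<delta> y x, new_t \<delta> y)) has_derivative (\<lambda>h. (h, 0))) (at x)"
    unfolding new_x_def new_t_def by (auto intro!: derivative_eq_intros)
  show ?thesis
    using has_derivative_compose[OF c assms]
    by (simp add: in_old_coords_def has_field_derivative_def)
qed

definition lattice_shift ::
  "'a::real_normed_field \<Rightarrow> 'a \<Rightarrow> ('a \<Rightarrow> 'a \<Rightarrow> 'a) \<Rightarrow> 'a \<Rightarrow> int \<Rightarrow> 'a \<Rightarrow> 'a" where
  "lattice_shift \<alpha>2 \<delta> v y \<nu> = in_old_coords \<alpha>2 \<delta> v (y + of_int \<nu> * \<delta>)"

definition gen_sbsq ::
  "'a::real_normed_field \<Rightarrow> 'a \<Rightarrow> ('a \<Rightarrow> 'a \<Rightarrow> 'a) \<Rightarrow> 'a \<Rightarrow> 'a \<Rightarrow> 'a" where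
  "gen_sbsq b0 b1 v x t =
     3 * pdt (\<lambda>x t. pdt v x t / pdx v x t) x t
     + pdx (\<lambda>x t. pdx (pdx (pdx v)) x t / pdx v x t
                  + 3 / 2 * (((pdt v x t) ^ 2 - (pdx (pdx v) x t) ^ 2) / (pdx v x t) ^ 2)
                  - 4 * ((b1 + b0 * v x t) / pdx v x t)) x t"

definition schwarzian :: "('a::real_normed_field \<Rightarrow> 'a \<Rightarrow> 'a) \<Rightarrow> 'a \<Rightarrow> 'a \<Rightarrow> 'a" where
  "schwarzian v x t =
     pdx (pdx (pdx v)) x t / pdx v x t - 3 / 2 * (pdx (pdx v) x t / pdx v x t) ^ 2"

definition sbsq :: "('a::real_normed_field \<Rightarrow> 'a \<Rightarrow> 'a) \<Rightarrow> 'a \<Rightarrow> 'a \<Rightarrow> 'a" where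
  "sbsq v x t =
     3 * pdt (\<lambda>x t. pdt v x t / pdx v x t) x t
     + pdx (\<lambda>x t. schwarzian v x t + 3 / 2 * (pdt v x t / pdx v x t) ^ 2) x t"

definition mobius_invariant ::
  "(('a::real_normed_field \<Rightarrow> 'a \<Rightarrow> 'a) \<Rightarrow> 'a \<Rightarrow> 'a \<Rightarrow> 'a) \<Rightarrow> bool" where
  "mobius_invariant E \<longleftrightarrow>
     (\<forall>U v k l m n. open U \<longrightarrow> smooth_on2 U v \<longrightarrow> (\<forall>(x, t)\<in>U. pdx v x t \<noteq> 0) \<longrightarrow>
        (\<forall>(x, t)\<in>U. E v x t = 0) \<longrightarrow>
        k * n - l * m \<noteq> 0 \<longrightarrow> (\<forall>(x, t)\<in>U. m * v x t + n \<noteq> 0) \<longrightarrow>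
        (\<forall>(x, t)\<in>U. E (\<lambda>x t. (k * v x t + l) / (m * v x t + n)) x t = 0))"

end

(*
  Multiplying both sides of the three-point equation by their denominators and by suitable powers
  of delta leaves an expression W that is polynomial in the difference quotients and derivatives of
  the three functions.  Each of these is a smooth function evaluated along a curve that is
  quadratic in delta, so it has a Taylor expansion whose coefficients obey a recursion coming from
  the chain rule.  The coefficients of W at delta^0, delta^1, delta^2 cancel, and the one at delta^3
  is v_x^5/4 times the generalized Schwarzian Boussinesq expression, while the denominators tend
  to 3 v_x^5.

  The ratio v_t/v_x and the Schwarzian derivative are both Moebius invariant, hence so is the case
  b0 = b1 = 0.  Otherwise v = x + (2/3) b0 t^2 is a solution, but for 1/v the left-hand side is
  8 b0 + 8 b1 v, which is not identically 0.
*)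
theory Submission
  imports Defs "HOL-Computational_Algebra.Formal_Power_Series"
begin

text \<open>Smoothness gives no convergent Taylor series, and already over the complex numbers the
  mean value equation fails. Expansions are therefore finite, formal power series merely keep
  account of coefficients, and orders are gained by integrating with the mean value inequality.
  Asymptotic expansions may not be differentiated in general; this does no harm because the change
  of variables leaves \<partial>_x alone, so u' and u'' at a lattice point are \<open>pdx v\<close>
  and \<open>pdx (pdx v)\<close> at the shifted point and have expansions along the same curve. The
  point (\<open>X \<delta>\<close>, \<open>Y \<delta>\<close>) moves with \<delta> so that (\<xi>,
  \<tau>) stays fixed; for \<tau> \<noteq> 0 the old coordinate y = 2 \<tau> / \<delta> is
  unbounded. The 1/3 in the change of variables removes an unwanted term: with a shift of x by
  \<delta> + \<beta> \<delta>^2 for arbitrary \<beta>, the coefficient of W at \<delta>^3 would also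
  contain (\<alpha>2 + 3 \<beta>) v_x^5 \<partial>_x (v_t / v_x).\<close>

section \<open>Finite asymptotic expansions\<close>

unbundle no vec_syntax
unbundle fps_syntax

text \<open>
  Says that \<open>f x = (\<Sum>i\<le>n. F $ i * x ^ i) + o(x ^ n)\<close> as \<open>x \<rightarrow> 0\<close>; peeling off one coefficient at
  a time makes the rule for products a short induction.
\<close>

primrec expands :: "nat \<Rightarrow> ('a::real_normed_field \<Rightarrow> 'a) \<Rightarrow> 'a fps \<Rightarrow> bool" where
  "expands 0 f F \<longleftrightarrow> (f \<longlongrightarrow> F $ 0) (at 0)"
| "expands (Suc n) f F \<longleftrightarrow> expands n (\<lambda>x. (f x - F $ 0) / x) (fps_shift 1 F)"

lemma expands_cong:
  assumes "\<forall>\<^sub>F x in at 0. f x = g x"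
  shows "expands n f F \<longleftrightarrow> expands n g F"
  using assms
proof (induction n arbitrary: f g F)
  case 0
  then show ?case by (simp add: tendsto_cong)
next
  case (Suc n)
  have "\<forall>\<^sub>F x in at 0. (f x - F $ 0) / x = (g x - F $ 0) / x"
    using Suc.prems by eventually_elim simp
  from Suc.IH[OF this] show ?case by simp
qed

lemma expands_SucD: "expands (Suc n) f F \<Longrightarrow> expands n f F"
proof (induction n arbitrary: f F)
  case 0
  then have "((\<lambda>x. (f x - F $ 0) / x) \<longlongrightarrow> F $ 1) (at 0)" by simp
  from tendsto_add[OF tendsto_mult[OF tendsto_ident_at this] tendsto_const[of "F $ 0"]]
  have "((\<lambda>x. x * ((f x - F $ 0) / x) + F $ 0) \<longlongrightarrow> F $ 0) (at 0)" by simp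
  then have "(f \<longlongrightarrow> F $ 0) (at 0)"
    by (rule Lim_transform_eventually) (auto simp: eventually_at_filter)
  then show ?case by simp
next
  case (Suc n)
  from Suc.prems have "expands (Suc n) (\<lambda>x. (f x - F $ 0) / x) (fps_shift 1 F)"
    by (subst (asm) expands.simps)
  from Suc.IH[OF this] show ?case by simp
qed

lemma expands_le: "expands n f F \<Longrightarrow> m \<le> n \<Longrightarrow> expands m f F"
  by (induction n) (auto simp: le_Suc_eq dest: expands_SucD simp del: expands.simps)

lemma expands_tendsto: "expands n f F \<Longrightarrow> (f \<longlongrightarrow> F $ 0) (at 0)"
  using expands_le[of n f F 0] by simp

lemma expands_const: "expands n (\<lambda>_. c) (fps_const c)"
proof (induction n arbitrary: c)
  case (Suc n)
  have "fps_shift 1 (fps_const c) = 0"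
    by (rule fps_ext) simp
  with Suc[of 0] show ?case by simp
qed simp

lemma expands_add: "expands n f F \<Longrightarrow> expands n g G \<Longrightarrow> expands n (\<lambda>x. f x + g x) (F + G)"
proof (induction n arbitrary: f g F G)
  case 0
  then show ?case by (auto intro: tendsto_add)
next
  case (Suc n)
  then have "expands n (\<lambda>x. (f x - F $ 0) / x + (g x - G $ 0) / x) (fps_shift 1 F + fps_shift 1 G)"
    by simp
  then show ?case
    by (simp add: fps_shift_add diff_divide_distrib add_divide_distrib algebra_simps)
qed

lemma expands_minus: "expands n f F \<Longrightarrow> expands n (\<lambda>x. - f x) (- F)"
proof (induction n arbitrary: f F)
  case 0
  then show ?case by (auto intro: tendsto_minus)
next
  case (Suc n)
  then have "expands n (\<lambda>x. - ((f x - F $ 0) / x)) (- fps_shift 1 F)"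
    by simp
  then show ?case
    by (simp add: fps_shift_uminus diff_divide_distrib)
qed

lemma expands_diff: "expands n f F \<Longrightarrow> expands n g G \<Longrightarrow> expands n (\<lambda>x. f x - g x) (F - G)"
  using expands_add[OF _ expands_minus, of n f F g G] by simp

text \<open>This is f g - f(0) g(0) = (f - f(0)) g + f(0) (g - g(0)), divided by the
  variable.\<close>

lemma fps_shift_1_mult:
  "fps_shift 1 (F * G) = fps_shift 1 F * G + fps_const (F $ 0) * fps_shift 1 (G::'a::comm_ring_1 fps)"
proof (rule fps_ext)
  fix n
  have "fps_shift 1 (F * G) $ n = (\<Sum>i=0..Suc n. F $ i * G $ (Suc n - i))"
    by (simp add: fps_mult_nth)
  also have "\<dots> = F $ 0 * G $ Suc n + (\<Sum>i=0..n. F $ Suc i * G $ (n - i))"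
    unfolding sum.atLeast0_atMost_Suc_shift by simp
  finally show "fps_shift 1 (F * G) $ n =
      (fps_shift 1 F * G + fps_const (F $ 0) * fps_shift 1 G) $ n"
    unfolding fps_add_nth fps_mult_left_const_nth by (simp add: fps_mult_nth)
qed

lemma expands_mult:
  fixes f g :: "'a::real_normed_field \<Rightarrow> 'a"
  shows "expands n f F \<Longrightarrow> expands n g G \<Longrightarrow> expands n (\<lambda>x. f x * g x) (F * G)"
proof (induction n arbitrary: f g F G)
  case 0
  then show ?case by (auto intro: tendsto_mult)
next
  case (Suc n)
  have cm: "expands n (\<lambda>x. c * h x) (fps_const c * H)" if "expands n h H" for c :: 'a and h H
    using Suc.IH[OF expands_const that] .
  \<comment> \<open>The undivided \<open>g\<close> is needed only to order \<open>n\<close>, because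
    its cofactor has already been divided by x.\<close>
  have "expands n (\<lambda>x. (f x - F $ 0) / x * g x + F $ 0 * ((g x - G $ 0) / x))
          (fps_shift 1 F * G + fps_const (F $ 0) * fps_shift 1 G)"
    using Suc.prems by (intro expands_add Suc.IH cm expands_SucD[OF Suc.prems(2)]) simp_all
  moreover have "(f x - F $ 0) / x * g x + F $ 0 * ((g x - G $ 0) / x)
      = (f x * g x - (F * G) $ 0) / x" for x
    by (simp add: diff_divide_distrib algebra_simps)
  ultimately show ?case
    unfolding expands.simps fps_shift_1_mult by simp
qed

lemma expands_X: "expands n (\<lambda>x. x) fps_X"
proof (cases n)
  case (Suc m)
  have "expands m (\<lambda>_. 1::'a) 1" using expands_const[of m 1] by simp
  moreover have "\<forall>\<^sub>F x::'a in at 0. (x - fps_X $ 0) / x = 1"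
    by (auto simp: eventually_at_filter)
  ultimately show ?thesis
    unfolding Suc expands.simps by (subst expands_cong) (auto simp: fps_shift_fps_X)
qed simp

text \<open>The recursive form suits algebra, the Peano form of the remainder suits estimates; this
  is the passage between them.\<close>

lemma expands_iff_remainder:
  "expands n f F \<longleftrightarrow> ((\<lambda>x. (f x - (\<Sum>i\<le>n. F $ i * x ^ i)) / x ^ n) \<longlongrightarrow> 0) (at 0)"
proof (induction n arbitrary: f F)
  case 0
  show ?case by (simp add: LIM_zero_iff)
next
  case (Suc n)
  have "\<forall>\<^sub>F x in at 0. ((f x - F $ 0) / x - (\<Sum>i\<le>n. fps_shift 1 F $ i * x ^ i)) / x ^ n
     = (f x - (\<Sum>i\<le>Suc n. F $ i * x ^ i)) / x ^ Suc n"
    unfolding eventually_at_filter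
  proof (intro always_eventually allI impI)
    fix x :: 'a assume "x \<noteq> 0"
    then show "((f x - F $ 0) / x - (\<Sum>i\<le>n. fps_shift 1 F $ i * x ^ i)) / x ^ n
       = (f x - (\<Sum>i\<le>Suc n. F $ i * x ^ i)) / x ^ Suc n"
      by (subst sum.atMost_Suc_shift)
        (simp add: field_simps sum_distrib_left)
  qed
  from tendsto_cong[OF this] show ?case by (simp add: Suc.IH)
qed

text \<open>The remainder of g has the remainder of g' as its derivative, and the latter is o(x^n).
  The mean value inequality on the ball of radius |x| then gains one factor |x|. Together with the
  chain rule this takes the place of Taylor's theorem.\<close>

lemma expands_integrate:
  fixes g g' :: "'a::real_normed_field \<Rightarrow> 'a"
  assumes der: "\<forall>\<^sub>F x in nhds 0. (g has_field_derivative g' x) (at x)"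
    and exp: "expands n g' (fps_deriv F)"
    and g0: "g 0 = F $ 0" and g'0: "g' 0 = F $ 1"
  shows "expands (Suc n) g F"
proof -
  define R where "R x = g x - (\<Sum>i\<le>Suc n. F $ i * x ^ i)" for x
  define R' where "R' x = g' x - (\<Sum>i\<le>n. fps_deriv F $ i * x ^ i)" for x
  have poly0: "(\<Sum>i\<le>m. c i * 0 ^ i) = c 0" for c :: "nat \<Rightarrow> 'a" and m
    by (induction m) simp_all
  have R0: "R 0 = 0"
    by (simp only: R_def poly0 g0 diff_self)
  have R'0: "R' 0 = 0"
    unfolding R'_def poly0 by (simp add: g'0)
  have derR: "(R has_field_derivative R' x) (at x)"
    if "(g has_field_derivative g' x) (at x)" for x
  proof -
    have "((\<lambda>x. \<Sum>i\<le>n. F $ Suc i * x ^ Suc i) has_field_derivative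
        (\<Sum>i\<le>n. fps_deriv F $ i * x ^ i)) (at x)"
      by (intro DERIV_sum) (auto intro!: derivative_eq_intros simp del: power_Suc)
    from DERIV_diff[OF that DERIV_add[OF DERIV_const[of "F $ 0"] this]]
    show ?thesis
      unfolding R_def[abs_def] R'_def
      by (subst sum.atMost_Suc_shift) simp
  qed
  have "((\<lambda>x. R x / x ^ Suc n) \<longlongrightarrow> 0) (at 0)"
  proof (rule tendstoI)
    fix e :: real assume e: "e > 0"
    from exp have "((\<lambda>x. R' x / x ^ n) \<longlongrightarrow> 0) (at 0)"
      unfolding R'_def expands_iff_remainder .
    then have "\<forall>\<^sub>F x in at 0. norm (R' x / x ^ n) < e / 2"
      using tendstoD[of _ 0 _ "e / 2"] e by fastforce
    then obtain d1 where "d1 > 0" "\<forall>x\<in>UNIV. x \<noteq> 0 \<and> dist x 0 < d1 \<longrightarrow> norm (R' x / x ^ n) < e / 2"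
      unfolding eventually_at by blast
    then have d1: "d1 > 0" "\<And>x. x \<noteq> 0 \<Longrightarrow> norm x < d1 \<Longrightarrow> norm (R' x / x ^ n) < e / 2"
      by simp_all
    from der obtain d2 where "d2 > 0" "\<forall>x. dist x 0 < d2 \<longrightarrow> (g has_field_derivative g' x) (at x)"
      unfolding eventually_nhds_metric by blast
    then have d2: "d2 > 0" "\<And>x. norm x < d2 \<Longrightarrow> (g has_field_derivative g' x) (at x)"
      by simp_all
    have "norm (R x / x ^ Suc n) < e" if x: "x \<noteq> 0" "norm x < min d1 d2" for x
    proof -
      have "norm (R x - R 0) \<le> (e / 2 * norm x ^ n) * norm (x - 0)"
      proof (rule field_differentiable_bound[of "cball 0 (norm x)" R R'])
        fix z :: 'a assume z: "z \<in> cball 0 (norm x)"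
        then show "(R has_field_derivative R' z) (at z within cball 0 (norm x))"
          using x d2 by (intro has_field_derivative_at_within[OF derR]) auto
        show "norm (R' z) \<le> e / 2 * norm x ^ n"
        proof (cases "z = 0")
          \<comment> \<open>The estimate of \<open>R' z / z ^ n\<close> says nothing at the centre
            of the ball; there \<open>R' 0 = 0\<close> is used, which comes from
            \<open>g' 0 = F $ 1\<close>.\<close>
          case True
          then show ?thesis using e by (simp add: R'0)
        next
          case False
          with z x d1(2)[of z] have "norm (R' z) \<le> e / 2 * norm z ^ n"
            by (simp add: norm_divide norm_power field_simps)
          also have "\<dots> \<le> e / 2 * norm x ^ n"
            using z e by (intro mult_left_mono power_mono) auto
          finally show ?thesis .
        qed
      qed auto
      then have "norm (R x / x ^ Suc n) \<le> e / 2"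
        using x by (simp add: R0 norm_divide norm_power norm_mult field_simps)
      with e show ?thesis by linarith
    qed
    then show "\<forall>\<^sub>F x in at 0. dist (R x / x ^ Suc n) 0 < e"
      unfolding eventually_at using d1(1) d2(1)
      by (intro exI[of _ "min d1 d2"]) (auto simp: dist_norm)
  qed
  then show ?thesis
    unfolding expands_iff_remainder R_def .
qed

section \<open>Calculus of functions of two variables\<close>

lemma iterated_partials_trans:
  "h \<in> iterated_partials g \<Longrightarrow> g \<in> iterated_partials f \<Longrightarrow> h \<in> iterated_partials f"
  by (induction rule: iterated_partials.induct) (auto intro: iterated_partials.intros)

lemma smooth_on2_iterated_partial:
  "smooth_on2 U f \<Longrightarrow> g \<in> iterated_partials f \<Longrightarrow> smooth_on2 U g"
  unfolding smooth_on2_def by (meson iterated_partials_trans)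

lemma smooth_on2_pdx: "smooth_on2 U f \<Longrightarrow> smooth_on2 U (pdx f)"
  and smooth_on2_pdt: "smooth_on2 U f \<Longrightarrow> smooth_on2 U (pdt f)"
  by (auto intro: smooth_on2_iterated_partial iterated_partials.intros)

lemma smooth_on2_continuous: "smooth_on2 U f \<Longrightarrow> continuous_on U (\<lambda>(x, t). f x t)"
  unfolding smooth_on2_def by (meson iterated_partials.base)

lemma smooth_on2_DERIV_x:
  assumes "smooth_on2 U f" "(x, t) \<in> U"
  shows "((\<lambda>s. f s t) has_field_derivative pdx f x t) (at x)"
  unfolding pdx_def DERIV_deriv_iff_field_differentiable
  using assms iterated_partials.base[of f] unfolding smooth_on2_def by blast

lemma smooth_on2_DERIV_t:
  assumes "smooth_on2 U f" "(x, t) \<in> U"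
  shows "((\<lambda>s. f x s) has_field_derivative pdt f x t) (at t)"
  unfolding pdt_def DERIV_deriv_iff_field_differentiable
  using assms iterated_partials.base[of f] unfolding smooth_on2_def by blast

lemma open_contains_ball_times:
  fixes U :: "('a::metric_space \<times> 'b::metric_space) set"
  assumes "open U" "(x, t) \<in> U"
  obtains d where "d > 0" "ball x d \<times> ball t d \<subseteq> U"
proof -
  from open_prod_elim[OF assms] obtain A B
    where AB: "open A" "open B" "(x, t) \<in> A \<times> B" "A \<times> B \<subseteq> U" by blast
  then obtain d e where "d > 0" "ball x d \<subseteq> A" "e > 0" "ball t e \<subseteq> B"
    unfolding open_contains_ball by blast
  with AB(4) that[of "min d e"] show thesis
    by (force simp: subset_iff)
qed

text \<open>\<open>smooth_on2\<close> speaks of the two partial derivatives separately, whereas the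
  chain rule along a curve asks for a total derivative. Differentiability in x at the point and
  joint continuity of the t-derivative provide it. \<open>blinfun_mult_right\<close> turns the
  t-derivative into an operator-valued function, the form in which its continuity is
  demanded.\<close>

lemma smooth_on2_has_derivative:
  fixes f :: "'a::real_normed_field \<Rightarrow> 'a \<Rightarrow> 'a"
  assumes "open U" "smooth_on2 U f" "(x, t) \<in> U"
  shows "((\<lambda>(x, t). f x t) has_derivative (\<lambda>(h, k). pdx f x t * h + pdt f x t * k)) (at (x, t))"
proof -
  obtain d where d: "d > 0" "ball x d \<times> ball t d \<subseteq> U"
    using open_contains_ball_times[OF assms(1,3)] .
  have opn: "open (ball x d \<times> ball t d)" by (simp add: open_Times)
  have mem: "(x, t) \<in> ball x d \<times> ball t d" using d(1) by simp
  have cont: "continuous (at (x, t)) (\<lambda>(x, t). blinfun_mult_right (pdt f x t))"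
  proof -
    have "continuous (at (x, t)) (\<lambda>(x, t). pdt f x t)"
      using smooth_on2_continuous[OF smooth_on2_pdt[OF assms(2)]] assms(1,3)
      by (simp add: continuous_on_eq_continuous_at)
    from bounded_linear.continuous[OF bounded_linear_blinfun_mult_right this]
    show ?thesis by (simp add: case_prod_unfold)
  qed
  have "((\<lambda>(x, t). f x t) has_derivative
      (\<lambda>(h, k). pdx f x t * h + blinfun_mult_right (pdt f x t) k)) (at (x, t) within ball x d \<times> ball t d)"
  proof (rule has_derivative_partialsI)
    show "((\<lambda>x. f x t) has_derivative (*) (pdx f x t)) (at x within ball x d)"
      using smooth_on2_DERIV_x[OF assms(2,3)]
      by (simp add: has_field_derivative_def has_derivative_at_withinI)
    show "((\<lambda>s. f p s) has_derivative blinfun_mult_right (pdt f p q)) (at q within ball t d)"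
      if "p \<in> ball x d" "q \<in> ball t d" for p q
      using smooth_on2_DERIV_t[OF assms(2), of p q] that d(2)
      by (auto simp: has_field_derivative_def has_derivative_at_withinI subset_iff)
  qed (use cont d mem in \<open>auto intro: continuous_at_imp_continuous_at_within\<close>)
  then show ?thesis
    using at_within_open[OF mem opn] by simp
qed

lemma smooth_on2_chain:
  fixes f :: "'a::real_normed_field \<Rightarrow> 'a \<Rightarrow> 'a"
  assumes "open U" "smooth_on2 U f" "(p s, q s) \<in> U"
    and "(p has_field_derivative p') (at s)" "(q has_field_derivative q') (at s)"
  shows "((\<lambda>s. f (p s) (q s)) has_field_derivative
           p' * pdx f (p s) (q s) + q' * pdt f (p s) (q s)) (at s)"
proof -
  have "((\<lambda>s. (p s, q s)) has_derivative (\<lambda>h. (p' * h, q' * h))) (at s)"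
    using assms(4,5) by (auto intro!: has_derivative_Pair simp: has_field_derivative_def)
  from has_derivative_compose[OF this smooth_on2_has_derivative[OF assms(1-3)]]
  have "((\<lambda>s. f (p s) (q s)) has_derivative
      (\<lambda>h. pdx f (p s) (q s) * (p' * h) + pdt f (p s) (q s) * (q' * h))) (at s)"
    by simp
  also have "(\<lambda>h. pdx f (p s) (q s) * (p' * h) + pdt f (p s) (q s) * (q' * h))
      = (*) (p' * pdx f (p s) (q s) + q' * pdt f (p s) (q s))"
    by (simp add: fun_eq_iff algebra_simps)
  finally show ?thesis by (simp only: has_field_derivative_def)
qed

section \<open>Equality of mixed partial derivatives\<close>

text \<open>Schwarz's argument with the mean value inequality applied once in each variable. Only
  one order of differentiation occurs, so that exchanging the roles of the variables later gives the
  other mixed derivative as a limit of the same quotient.\<close>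

lemma mixed_difference_quotient:
  fixes f g h :: "'a::real_normed_field \<Rightarrow> 'a \<Rightarrow> 'a"
  assumes U: "open U" "(x, t) \<in> U"
    and f: "\<And>p q. (p, q) \<in> U \<Longrightarrow> ((\<lambda>s. f s q) has_field_derivative g p q) (at p)"
    and g: "\<And>p q. (p, q) \<in> U \<Longrightarrow> ((\<lambda>s. g p s) has_field_derivative h p q) (at q)"
    and h: "continuous_on U (\<lambda>(p, q). h p q)"
  shows "((\<lambda>s. (f (x + s) (t + s) - f (x + s) t - f x (t + s) + f x t) / s ^ 2) \<longlongrightarrow> h x t) (at 0)"
proof (rule tendstoI)
  fix e :: real assume e: "e > 0"
  let ?V = "{z\<in>U. dist ((\<lambda>(p, q). h p q) z) (h x t) < e / 2}"
  have "open ?V"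
  proof -
    have "continuous_on U (\<lambda>z. dist ((\<lambda>(p, q). h p q) z) (h x t))"
      by (intro continuous_on_dist h continuous_on_const)
    then have "open ((\<lambda>z. dist ((\<lambda>(p, q). h p q) z) (h x t)) -` {..<e / 2} \<inter> U)"
      using U(1) by (simp add: continuous_on_open_vimage)
    moreover have "(\<lambda>z. dist ((\<lambda>(p, q). h p q) z) (h x t)) -` {..<e / 2} \<inter> U = ?V"
      by auto
    ultimately show ?thesis by simp
  qed
  moreover have "(x, t) \<in> ?V" using U(2) e by simp
  ultimately obtain d where d: "d > 0" "ball x d \<times> ball t d \<subseteq> ?V"
    using open_contains_ball_times by blast
  have "norm ((f (x + s) (t + s) - f (x + s) t - f x (t + s) + f x t) / s ^ 2 - h x t) \<le> e / 2"
    if s: "s \<noteq> 0" "norm s < d" for s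
  proof -
    have in_V: "(p, q) \<in> ?V" if "p \<in> cball x (norm s)" "q \<in> cball t (norm s)" for p q
    proof -
      have "(p, q) \<in> ball x d \<times> ball t d" using that s by simp
      then show ?thesis using d(2) by blast
    qed
    \<comment> \<open>The second difference is the increment of \<open>f p (t + s) - f p t\<close>
      as p runs from x to x + s. Subtracting the linear function \<open>s * h x t * p\<close>
      reduces the claim to a bound on a derivative; the inner estimate treats \<open>g p q\<close>
      in the same way by subtracting \<open>h x t * q\<close>.\<close>
    have "norm ((f (x + s) (t + s) - f (x + s) t - s * h x t * (x + s))
              - (f x (t + s) - f x t - s * h x t * x)) \<le> (e / 2 * norm s) * norm ((x + s) - x)"
    proof (rule field_differentiable_bound[of "cball x (norm s)"
          "\<lambda>p. f p (t + s) - f p t - s * h x t * p" "\<lambda>p. g p (t + s) - g p t - s * h x t"])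
      fix p assume p: "p \<in> cball x (norm s)"
      have "((\<lambda>p. f p (t + s)) has_field_derivative g p (t + s)) (at p)"
        "((\<lambda>p. f p t) has_field_derivative g p t) (at p)"
        using in_V[OF p, of "t + s"] in_V[OF p, of t] by (auto intro!: f simp: dist_norm)
      from DERIV_diff[OF DERIV_diff[OF this] DERIV_cmult_Id[of "s * h x t"]]
      show "((\<lambda>p. f p (t + s) - f p t - s * h x t * p) has_field_derivative
          g p (t + s) - g p t - s * h x t) (at p within cball x (norm s))"
        by (rule has_field_derivative_at_within)
      have "norm ((g p (t + s) - h x t * (t + s)) - (g p t - h x t * t)) \<le> e / 2 * norm ((t + s) - t)"
      proof (rule field_differentiable_bound[of "cball t (norm s)"
            "\<lambda>q. g p q - h x t * q" "\<lambda>q. h p q - h x t"])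
        fix q assume q: "q \<in> cball t (norm s)"
        have "((\<lambda>q. g p q) has_field_derivative h p q) (at q)"
          using in_V[OF p q] by (auto intro!: g)
        from DERIV_diff[OF this DERIV_cmult_Id[of "h x t"]]
        show "((\<lambda>q. g p q - h x t * q) has_field_derivative h p q - h x t)
            (at q within cball t (norm s))"
          by (rule has_field_derivative_at_within)
        show "norm (h p q - h x t) \<le> e / 2"
          using in_V[OF p q] by (simp add: dist_norm)
      qed (auto simp: dist_norm)
      then show "norm (g p (t + s) - g p t - s * h x t) \<le> e / 2 * norm s"
        by (simp add: algebra_simps)
    qed (auto simp: dist_norm)
    then have "norm ((f (x + s) (t + s) - f (x + s) t - f x (t + s) + f x t) - s ^ 2 * h x t)
        \<le> e / 2 * norm s ^ 2"
      by (simp add: algebra_simps power2_eq_square)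
    moreover have "(f (x + s) (t + s) - f (x + s) t - f x (t + s) + f x t) / s ^ 2 - h x t
       = ((f (x + s) (t + s) - f (x + s) t - f x (t + s) + f x t) - s ^ 2 * h x t) / s ^ 2"
      using s by (simp add: field_simps)
    ultimately show ?thesis
      using s by (simp add: norm_divide norm_power field_simps)
  qed
  then have "\<forall>s\<in>UNIV. s \<noteq> 0 \<and> dist s 0 < d \<longrightarrow>
      dist ((f (x + s) (t + s) - f (x + s) t - f x (t + s) + f x t) / s ^ 2) (h x t) < e"
    using e by (auto simp: dist_norm simp del: le_divide_eq_numeral1 intro: le_less_trans[of _ "e / 2"])
  then show "\<forall>\<^sub>F s in at 0.
      dist ((f (x + s) (t + s) - f (x + s) t - f x (t + s) + f x t) / s ^ 2) (h x t) < e"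
    unfolding eventually_at using d(1) by blast
qed

text \<open>The second difference is symmetric in the two directions, so both mixed derivatives are
  its limit. The exchanged version lives on the mirrored set \<open>?V\<close>.\<close>

lemma smooth_on2_partials_commute:
  fixes f :: "'a::real_normed_field \<Rightarrow> 'a \<Rightarrow> 'a"
  assumes U: "open U" "(x, t) \<in> U" and f: "smooth_on2 U f"
  shows "pdt (pdx f) x t = pdx (pdt f) x t"
proof (rule tendsto_unique)
  show "((\<lambda>s. (f (x + s) (t + s) - f (x + s) t - f x (t + s) + f x t) / s ^ 2) \<longlongrightarrow> pdt (pdx f) x t) (at 0)"
    using f U by (intro mixed_difference_quotient[of U _ _ _ "pdx f"])
      (auto intro: smooth_on2_DERIV_x smooth_on2_DERIV_t smooth_on2_continuous smooth_on2_pdx smooth_on2_pdt)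
  let ?V = "prod.swap -` U"
  have V: "open ?V"
    by (intro open_vimage U continuous_intros)
  have cont: "continuous_on ?V (\<lambda>(q, p). pdx (pdt f) p q)"
  proof -
    have "continuous_on ?V ((\<lambda>(p, q). pdx (pdt f) p q) \<circ> prod.swap)"
      by (intro continuous_on_compose continuous_intros continuous_on_subset
          [OF smooth_on2_continuous[OF smooth_on2_pdx[OF smooth_on2_pdt[OF f]]]]) auto
    then show ?thesis by (simp add: case_prod_unfold o_def)
  qed
  have "((\<lambda>s. (f (x + s) (t + s) - f x (t + s) - f (x + s) t + f x t) / s ^ 2)
      \<longlongrightarrow> pdx (pdt f) x t) (at 0)"
    using f U cont V by (intro mixed_difference_quotient[of ?V t x "\<lambda>q p. f p q" "\<lambda>q p. pdt f p q"])
      (auto intro: smooth_on2_DERIV_x smooth_on2_DERIV_t smooth_on2_pdt)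
  then show "((\<lambda>s. (f (x + s) (t + s) - f (x + s) t - f x (t + s) + f x t) / s ^ 2)
      \<longlongrightarrow> pdx (pdt f) x t) (at 0)"
    by (simp add: algebra_simps)
qed simp

lemma open_slice_eventually:
  fixes x t :: "'a::real_normed_field"
  assumes "open U" "(x, t) \<in> U"
  shows "\<forall>\<^sub>F s in nhds x. (s, t) \<in> U" "\<forall>\<^sub>F s in nhds t. (x, s) \<in> U"
proof -
  obtain d where "d > 0" "ball x d \<times> ball t d \<subseteq> U"
    using open_contains_ball_times[OF assms] .
  then show "\<forall>\<^sub>F s in nhds x. (s, t) \<in> U" "\<forall>\<^sub>F s in nhds t. (x, s) \<in> U"
    unfolding eventually_nhds_metric by (auto intro!: exI[of _ d] simp: dist_commute)
qed

lemma pdx_cong: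
  assumes "open U" "(x, t) \<in> U" "\<And>p q. (p, q) \<in> U \<Longrightarrow> f p q = g p q"
  shows "pdx f x t = pdx g x t"
  unfolding pdx_def
  by (rule deriv_cong_ev[OF eventually_mono[OF open_slice_eventually(1)[OF assms(1,2)]]])
    (simp_all add: assms(3))

lemma pdt_cong:
  assumes "open U" "(x, t) \<in> U" "\<And>p q. (p, q) \<in> U \<Longrightarrow> f p q = g p q"
  shows "pdt f x t = pdt g x t"
  unfolding pdt_def
  by (rule deriv_cong_ev[OF eventually_mono[OF open_slice_eventually(2)[OF assms(1,2)]]])
    (simp_all add: assms(3))

section \<open>Taylor expansion along a quadratic curve\<close>

text \<open>
  Along the curve \<open>(\<xi> + \<sigma> \<delta> + \<beta> \<delta>\<^sup>2, \<tau> + \<gamma> \<delta>\<^sup>2)\<close> the chain rule reads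
  \<open>G' = (\<sigma> + 2 \<beta> \<delta>) G\<^sub>x + 2 \<gamma> \<delta> G\<^sub>t\<close>; comparing coefficients gives this recursion.
\<close>

fun curve_coeff :: "'a::real_normed_field \<Rightarrow> 'a \<Rightarrow> 'a \<Rightarrow> 'a \<Rightarrow> 'a \<Rightarrow> ('a \<Rightarrow> 'a \<Rightarrow> 'a) \<Rightarrow> nat \<Rightarrow> 'a" where
  "curve_coeff \<sigma> \<beta> \<gamma> \<xi> \<tau> g 0 = g \<xi> \<tau>"
| "curve_coeff \<sigma> \<beta> \<gamma> \<xi> \<tau> g (Suc 0) = \<sigma> * pdx g \<xi> \<tau>"
| "curve_coeff \<sigma> \<beta> \<gamma> \<xi> \<tau> g (Suc (Suc n)) =
     (\<sigma> * curve_coeff \<sigma> \<beta> \<gamma> \<xi> \<tau> (pdx g) (Suc n)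
      + 2 * \<beta> * curve_coeff \<sigma> \<beta> \<gamma> \<xi> \<tau> (pdx g) n
      + 2 * \<gamma> * curve_coeff \<sigma> \<beta> \<gamma> \<xi> \<tau> (pdt g) n) / of_nat (Suc (Suc n))"

text \<open>Induction on the order for all \<open>g\<close> at once: the derivative along the curve
  is a combination of \<open>pdx g\<close> and \<open>pdt g\<close>, which are smooth again and
  expand to order n by hypothesis, and integration adds one order.\<close>

lemma expands_along_curve:
  fixes g :: "'a::real_normed_field \<Rightarrow> 'a \<Rightarrow> 'a"
  assumes U: "open U" "(\<xi>, \<tau>) \<in> U" and g: "smooth_on2 U g"
  shows "expands n (\<lambda>\<delta>. g (\<xi> + \<sigma> * \<delta> + \<beta> * \<delta> ^ 2) (\<tau> + \<gamma> * \<delta> ^ 2))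
           (Abs_fps (curve_coeff \<sigma> \<beta> \<gamma> \<xi> \<tau> g))"
  using g
proof (induction n arbitrary: g)
  case 0
  have "isCont (\<lambda>\<delta>. (\<xi> + \<sigma> * \<delta> + \<beta> * \<delta> ^ 2, \<tau> + \<gamma> * \<delta> ^ 2)) 0"
    by (intro continuous_intros)
  moreover have "isCont (\<lambda>(x, t). g x t) (\<xi> + \<sigma> * 0 + \<beta> * 0 ^ 2, \<tau> + \<gamma> * 0 ^ 2)"
    using smooth_on2_continuous[OF 0] U by (simp add: continuous_on_eq_continuous_at)
  ultimately have "isCont (\<lambda>\<delta>. (\<lambda>(x, t). g x t) (\<xi> + \<sigma> * \<delta> + \<beta> * \<delta> ^ 2, \<tau> + \<gamma> * \<delta> ^ 2)) 0"
    by (rule isCont_o2)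
  then show ?case by (simp add: isCont_def)
next
  case (Suc n)
  let ?F = "\<lambda>g. Abs_fps (curve_coeff \<sigma> \<beta> \<gamma> \<xi> \<tau> g)"
  let ?p = "\<lambda>\<delta>. \<xi> + \<sigma> * \<delta> + \<beta> * \<delta> ^ 2" and ?q = "\<lambda>\<delta>. \<tau> + \<gamma> * \<delta> ^ 2"
  have "isCont (\<lambda>\<delta>. (?p \<delta>, ?q \<delta>)) 0"
    by (intro continuous_intros)
  then have "((\<lambda>\<delta>. (?p \<delta>, ?q \<delta>)) \<longlongrightarrow> (?p 0, ?q 0)) (nhds 0)"
    unfolding isCont_def using tendsto_at_iff_tendsto_nhds[of "\<lambda>\<delta>. (?p \<delta>, ?q \<delta>)" 0] by blast
  then have ev: "\<forall>\<^sub>F \<delta> in nhds 0. (?p \<delta>, ?q \<delta>) \<in> U"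
    by (rule topological_tendstoD) (use U in simp_all)
  show ?case
  proof (rule expands_integrate)
    show "\<forall>\<^sub>F \<delta> in nhds 0. ((\<lambda>\<delta>. g (?p \<delta>) (?q \<delta>)) has_field_derivative
        (\<sigma> + 2 * \<beta> * \<delta>) * pdx g (?p \<delta>) (?q \<delta>) + 2 * \<gamma> * \<delta> * pdt g (?p \<delta>) (?q \<delta>)) (at \<delta>)"
      using ev
      by eventually_elim
        (rule smooth_on2_chain[OF U(1) Suc.prems]; auto intro!: derivative_eq_intros)
    have "fps_deriv (?F g) = (fps_const \<sigma> + fps_const (2 * \<beta>) * fps_X) * ?F (pdx g)
        + fps_const (2 * \<gamma>) * fps_X * ?F (pdt g)"
    proof (rule fps_ext)
      fix k
      show "fps_deriv (?F g) $ k = ((fps_const \<sigma> + fps_const (2 * \<beta>) * fps_X) * ?F (pdx g)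
        + fps_const (2 * \<gamma>) * fps_X * ?F (pdt g)) $ k"
        by (cases k) (simp_all add: field_simps of_nat_neq_0 mult.assoc del: of_nat_Suc)
    qed
    moreover have "expands n (\<lambda>\<delta>. (\<sigma> + 2 * \<beta> * \<delta>) * pdx g (?p \<delta>) (?q \<delta>)
          + 2 * \<gamma> * \<delta> * pdt g (?p \<delta>) (?q \<delta>))
        ((fps_const \<sigma> + fps_const (2 * \<beta>) * fps_X) * ?F (pdx g)
          + fps_const (2 * \<gamma>) * fps_X * ?F (pdt g))"
      by (intro expands_add expands_mult expands_const expands_X Suc.IH
          smooth_on2_pdx smooth_on2_pdt Suc.prems)
    ultimately show "expands n (\<lambda>\<delta>. (\<sigma> + 2 * \<beta> * \<delta>) * pdx g (?p \<delta>) (?q \<delta>)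
          + 2 * \<gamma> * \<delta> * pdt g (?p \<delta>) (?q \<delta>)) (fps_deriv (?F g))"
      by simp
  qed simp_all
qed

section \<open>Moebius transformations\<close>

lemma pdx_eqI: "((\<lambda>s. f s t) has_field_derivative D) (at x) \<Longrightarrow> pdx f x t = D"
  unfolding pdx_def by (rule DERIV_imp_deriv)

lemma pdt_eqI: "((\<lambda>s. f x s) has_field_derivative D) (at t) \<Longrightarrow> pdt f x t = D"
  unfolding pdt_def by (rule DERIV_imp_deriv)

text \<open>Made for iterated partials: the inner derivative is known by a formula on U only, and
  differentiation is applied to that formula.\<close>

lemma pdx_eqI_on:
  assumes "open U" "(x, t) \<in> U" "\<And>p q. (p, q) \<in> U \<Longrightarrow> f p q = g p q"
    and "((\<lambda>s. g s t) has_field_derivative D) (at x)"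
  shows "pdx f x t = D"
  using pdx_cong[OF assms(1-3)] pdx_eqI[of g, OF assms(4)] by simp

lemma pdt_eqI_on:
  assumes "open U" "(x, t) \<in> U" "\<And>p q. (p, q) \<in> U \<Longrightarrow> f p q = g p q"
    and "((\<lambda>s. g x s) has_field_derivative D) (at t)"
  shows "pdt f x t = D"
  using pdt_cong[OF assms(1-3)] pdt_eqI[of g, OF assms(4)] by simp

lemma gen_sbsq_0_0: "gen_sbsq (0::'a::real_normed_field) 0 = sbsq"
proof (intro ext)
  fix v :: "'a \<Rightarrow> 'a \<Rightarrow> 'a" and x t
  have "pdx (pdx (pdx v)) x t / pdx v x t
        + 3 / 2 * (((pdt v x t) ^ 2 - (pdx (pdx v) x t) ^ 2) / (pdx v x t) ^ 2)
      = schwarzian v x t + 3 / 2 * (pdt v x t / pdx v x t) ^ 2" for x t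
    by (simp add: schwarzian_def power_divide diff_divide_distrib algebra_simps)
  then show "gen_sbsq 0 0 v x t = sbsq v x t"
    by (simp add: gen_sbsq_def sbsq_def)
qed

text \<open>Here \<open>a\<close>, \<open>b\<close>, \<open>c\<close> stand for the first three
  x-derivatives of v, \<open>M\<close> for the denominator m v + n and \<open>D\<close> for the
  determinant k n - l m. The function differentiated is w_xx for the transformed w.\<close>

lemma DERIV_mobius_second_partial:
  fixes a b M :: "'a::real_normed_field \<Rightarrow> 'a"
  assumes a: "(a has_field_derivative b x) (at x)" and b: "(b has_field_derivative c) (at x)"
    and M: "(M has_field_derivative m * a x) (at x)" and nz: "M x \<noteq> 0"
  shows "((\<lambda>s. D * (b s / M s ^ 2 - 2 * m * a s ^ 2 / M s ^ 3)) has_field_derivative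
    D * (c / M x ^ 2 - 6 * m * a x * b x / M x ^ 3 + 6 * m ^ 2 * a x ^ 3 / M x ^ 4)) (at x)"
  by (rule DERIV_cong, (rule a b M derivative_intros power_not_zero nz)+)
    (simp add: divide_simps nz, simp add: algebra_simps eval_nat_numeral)

lemma mobius_partials:
  fixes v :: "'a::real_normed_field \<Rightarrow> 'a \<Rightarrow> 'a" and k l m n :: 'a
  assumes U: "open U" and v: "smooth_on2 U v"
    and nz: "\<And>x t. (x, t) \<in> U \<Longrightarrow> m * v x t + n \<noteq> 0"
  defines "w \<equiv> \<lambda>x t. (k * v x t + l) / (m * v x t + n)"
  assumes xt: "(x, t) \<in> U"
  shows "pdt w x t = (k * n - l * m) * pdt v x t / (m * v x t + n) ^ 2"
    and "pdx w x t = (k * n - l * m) * pdx v x t / (m * v x t + n) ^ 2"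
    and "pdx (pdx w) x t = (k * n - l * m) *
      (pdx (pdx v) x t / (m * v x t + n) ^ 2 - 2 * m * pdx v x t ^ 2 / (m * v x t + n) ^ 3)"
    and "pdx (pdx (pdx w)) x t = (k * n - l * m) *
      (pdx (pdx (pdx v)) x t / (m * v x t + n) ^ 2
       - 6 * m * pdx v x t * pdx (pdx v) x t / (m * v x t + n) ^ 3
       + 6 * m ^ 2 * pdx v x t ^ 3 / (m * v x t + n) ^ 4)"
proof -
  note dv = smooth_on2_DERIV_t[OF v] smooth_on2_DERIV_x[OF v]
    smooth_on2_DERIV_x[OF smooth_on2_pdx[OF v]]
    smooth_on2_DERIV_x[OF smooth_on2_pdx[OF smooth_on2_pdx[OF v]]]
  show "pdt w x t = (k * n - l * m) * pdt v x t / (m * v x t + n) ^ 2"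
    unfolding w_def using nz xt
    by (intro pdt_eqI) (auto intro!: derivative_eq_intros dv simp: field_simps power2_eq_square)
  have w1: "pdx w x t = (k * n - l * m) * pdx v x t / (m * v x t + n) ^ 2" if "(x, t) \<in> U" for x t
    unfolding w_def using nz that
    by (intro pdx_eqI) (auto intro!: derivative_eq_intros dv simp: field_simps power2_eq_square)
  have w2: "pdx (pdx w) x t = (k * n - l * m) *
      (pdx (pdx v) x t / (m * v x t + n) ^ 2 - 2 * m * pdx v x t ^ 2 / (m * v x t + n) ^ 3)"
    if xt: "(x, t) \<in> U" for x t
    by (rule pdx_eqI_on[OF U xt w1], assumption, rule DERIV_cong,
        (rule dv xt derivative_intros power_not_zero nz[OF xt])+)
      (simp add: divide_simps nz[OF xt], simp add: algebra_simps eval_nat_numeral)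
  show "pdx (pdx (pdx w)) x t = (k * n - l * m) *
      (pdx (pdx (pdx v)) x t / (m * v x t + n) ^ 2
       - 6 * m * pdx v x t * pdx (pdx v) x t / (m * v x t + n) ^ 3
       + 6 * m ^ 2 * pdx v x t ^ 3 / (m * v x t + n) ^ 4)"
    by (rule pdx_eqI_on[OF U xt w2], assumption, rule DERIV_mobius_second_partial)
      (auto intro!: derivative_eq_intros dv xt nz)
  show "pdx w x t = (k * n - l * m) * pdx v x t / (m * v x t + n) ^ 2"
    by (rule w1[OF xt])
  show "pdx (pdx w) x t = (k * n - l * m) *
      (pdx (pdx v) x t / (m * v x t + n) ^ 2 - 2 * m * pdx v x t ^ 2 / (m * v x t + n) ^ 3)"
    by (rule w2[OF xt])
qed

text \<open>The transformation changes w_xx / w_x by -2 m a / M. Squaring this and multiplying by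
  -3/2 yields 6 m b / M - 6 m^2 a^2 / M^2, exactly opposite to the change of w_xxx / w_x.\<close>

lemma schwarzian_algebra:
  fixes D a b c m M :: "'a::real_normed_field"
  assumes "D \<noteq> 0" "a \<noteq> 0" "M \<noteq> 0"
  shows "D * (c / M ^ 2 - 6 * m * a * b / M ^ 3 + 6 * m ^ 2 * a ^ 3 / M ^ 4) / (D * a / M ^ 2)
      - 3 / 2 * (D * (b / M ^ 2 - 2 * m * a ^ 2 / M ^ 3) / (D * a / M ^ 2)) ^ 2
    = c / a - 3 / 2 * (b / a) ^ 2"
proof -
  have 1: "D * (c / M ^ 2 - 6 * m * a * b / M ^ 3 + 6 * m ^ 2 * a ^ 3 / M ^ 4) / (D * a / M ^ 2)
     = c / a - 6 * m * b / M + 6 * m ^ 2 * a ^ 2 / M ^ 2"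
    using assms by (simp add: divide_simps) (simp add: algebra_simps eval_nat_numeral)
  have 2: "D * (b / M ^ 2 - 2 * m * a ^ 2 / M ^ 3) / (D * a / M ^ 2) = b / a - 2 * m * a / M"
    using assms by (simp add: divide_simps) (simp add: algebra_simps eval_nat_numeral)
  show ?thesis
    unfolding 1 2 using assms by (simp add: divide_simps) (simp add: algebra_simps power2_eq_square)
qed

lemma mobius_invariant_sbsq: "mobius_invariant (sbsq :: ('a::real_normed_field \<Rightarrow> 'a \<Rightarrow> 'a) \<Rightarrow> 'a \<Rightarrow> 'a \<Rightarrow> 'a)"
  unfolding mobius_invariant_def
proof (intro allI impI ballI)
  fix U and v :: "'a \<Rightarrow> 'a \<Rightarrow> 'a" and k l m n z
  assume U: "open U" and v: "smooth_on2 U v" and vx: "\<forall>(x, t)\<in>U. pdx v x t \<noteq> 0"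
    and sol: "\<forall>(x, t)\<in>U. sbsq v x t = 0" and det: "k * n - l * m \<noteq> 0"
    and nz: "\<forall>(x, t)\<in>U. m * v x t + n \<noteq> 0" and z: "z \<in> U"
  define w where "w = (\<lambda>x t. (k * v x t + l) / (m * v x t + n))"
  obtain x t where xt: "z = (x, t)" "(x, t) \<in> U" using z by (cases z) simp
  have nz': "m * v x t + n \<noteq> 0" if "(x, t) \<in> U" for x t
    using nz that by auto
  have vx': "pdx v x t \<noteq> 0" if "(x, t) \<in> U" for x t
    using vx that by auto
  note p = mobius_partials[OF U v, of m n _ _ k l, folded w_def, OF nz']
  have ratio: "pdt w x t / pdx w x t = pdt v x t / pdx v x t" if "(x, t) \<in> U" for x t
    using det nz'[OF that] by (simp add: p that)
  have schw: "schwarzian w x t = schwarzian v x t" if "(x, t) \<in> U" for x t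
    by (simp only: schwarzian_def p that, rule schwarzian_algebra) (use det nz' vx' that in auto)
  \<comment> \<open>The whole expression is unchanged, not merely its zero set: it is built from v_t
    / v_x and the Schwarzian, both of which agree for \<open>w\<close> and \<open>v\<close>
    throughout U and hence under the outer derivatives.\<close>
  have "sbsq w x t = sbsq v x t"
    unfolding sbsq_def
    by (intro arg_cong2[where f = "(+)"] arg_cong2[where f = "(*)"] refl
        pdt_cong[OF U xt(2)] pdx_cong[OF U xt(2)]) (simp_all add: ratio schw)
  then show "case z of (x, t) \<Rightarrow> sbsq (\<lambda>x t. (k * v x t + l) / (m * v x t + n)) x t = 0"
    using sol xt by (auto simp: w_def)
qed

section \<open>Loss of invariance when b0 or b1 is nonzero\<close>

text \<open>
  For \<open>v = x + f t\<close> the equation reduces to \<open>3 f'' = 4 b0\<close>, whatever \<open>b1\<close> is.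
\<close>

definition travelling_parabola :: "'a::real_normed_field \<Rightarrow> 'a \<Rightarrow> 'a \<Rightarrow> 'a" where
  "travelling_parabola b x t = x + 2 / 3 * b * t ^ 2"

lemma pdx_travelling_parabola: "pdx (travelling_parabola b) = (\<lambda>x t. 1)"
  by (intro ext pdx_eqI) (auto intro!: derivative_eq_intros simp: travelling_parabola_def)

lemma pdt_travelling_parabola: "pdt (travelling_parabola b) = (\<lambda>x t. 4 / 3 * b * t)"
  by (intro ext pdt_eqI) (auto intro!: derivative_eq_intros simp: travelling_parabola_def)

lemma pdx_linear_t: "pdx (\<lambda>x t. c + d * t) = (\<lambda>x t::'a::real_normed_field. 0)"
  by (intro ext pdx_eqI) (auto intro!: derivative_eq_intros)

lemma pdt_linear_t: "pdt (\<lambda>x t. c + d * t) = (\<lambda>x t::'a::real_normed_field. d)"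
  by (intro ext pdt_eqI) (auto intro!: derivative_eq_intros)

text \<open>The parabola together with the functions c + d t is closed under both partial
  derivatives, so this family contains all iterated partials.\<close>

lemma smooth_on2_travelling_parabola: "smooth_on2 U (travelling_parabola b)"
proof -
  have iter: "g = travelling_parabola b \<or> (\<exists>c d. g = (\<lambda>x t. c + d * t))"
    if "g \<in> iterated_partials (travelling_parabola b)" for g
    using that
  proof induction
    case (pdx g)
    have "pdx (travelling_parabola b) = (\<lambda>x t. 1 + 0 * t)" by (simp add: pdx_travelling_parabola)
    moreover have "pdx (\<lambda>x t. c + d * t) = (\<lambda>x t. 0 + 0 * t)" for c d :: 'a
      by (simp add: pdx_linear_t)
    ultimately show ?case using pdx.IH by blast
  next
    case (pdt g)
    have "pdt (travelling_parabola b) = (\<lambda>x t. 0 + 4 / 3 * b * t)" by (simp add: pdt_travelling_parabola)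
    moreover have "pdt (\<lambda>x t. c + d * t) = (\<lambda>x t. d + 0 * t)" for c d :: 'a
      by (simp add: pdt_linear_t)
    ultimately show ?case using pdt.IH by blast
  qed simp
  have "continuous_on U (\<lambda>(x, t). g x t) \<and>
      (\<forall>(x, t)\<in>U. (\<lambda>s. g s t) field_differentiable (at x) \<and> (\<lambda>s. g x s) field_differentiable (at t))"
    if "g = travelling_parabola b \<or> (\<exists>c d. g = (\<lambda>x t. c + d * t))" for g
    using that
    by (auto simp: travelling_parabola_def[abs_def] case_prod_unfold
        intro!: continuous_intros field_differentiable_add field_differentiable_mult field_differentiable_divide
          field_differentiable_const field_differentiable_ident field_differentiable_power)
  with iter show ?thesis unfolding smooth_on2_def by blast
qed

lemma gen_sbsq_travelling_parabola: "gen_sbsq b0 b1 (travelling_parabola b0) x t = 0"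
proof -
  have 0: "pdx (\<lambda>x t. 1) = (\<lambda>x t::'a. 0)" "pdx (\<lambda>x t. 0) = (\<lambda>x t::'a. 0)"
    by (auto intro!: ext pdx_eqI derivative_eq_intros)
  have 1: "pdt (\<lambda>x t. 4 / 3 * b0 * t) x t = 4 / 3 * b0"
    by (intro pdt_eqI) (auto intro!: derivative_eq_intros)
  have 2: "pdx (\<lambda>x t. 3 / 2 * (4 / 3 * b0 * t) ^ 2 - 4 * (b1 + b0 * (x + 2 / 3 * b0 * t ^ 2))) x t = - 4 * b0"
    by (intro pdx_eqI) (auto intro!: derivative_eq_intros)
  show ?thesis
    unfolding gen_sbsq_def pdx_travelling_parabola pdt_travelling_parabola 0 div_by_1 1
    using 2 by (simp add: travelling_parabola_def)
qed

text \<open>Inversion preserves v_t / v_x and the Schwarzian; what changes is the flux of the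
  b-terms, from -4 (b1 + b0 u) to 4 (b1 u^2 + b0 u).\<close>

lemma gen_sbsq_inverse_travelling_parabola:
  fixes b0 b1 :: "'a::real_normed_field"
  assumes "travelling_parabola b0 x t \<noteq> 0"
  shows "gen_sbsq b0 b1 (\<lambda>x t. 1 / travelling_parabola b0 x t) x t
    = 8 * b0 + 8 * b1 * travelling_parabola b0 x t"
proof -
  let ?u = "travelling_parabola b0"
  define w where "w = (\<lambda>x t. 1 / ?u x t)"
  define U where "U = {z. ?u (fst z) (snd z) \<noteq> 0}"
  have U: "open U"
    unfolding U_def travelling_parabola_def
    by (intro open_Collect_neq continuous_intros)
  have xt: "(x, t) \<in> U" using assms by (simp add: U_def)
  have dux: "((\<lambda>s. ?u s t) has_field_derivative 1) (at x)" for x t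
    by (auto simp: travelling_parabola_def intro!: derivative_eq_intros)
  have dut: "((\<lambda>s. ?u x s) has_field_derivative 4 / 3 * b0 * t) (at t)" for x t
    by (auto simp: travelling_parabola_def intro!: derivative_eq_intros)
  have wt: "pdt w x t = - (4 / 3 * b0 * t) / ?u x t ^ 2" if "(x, t) \<in> U" for x t
    unfolding w_def using that
    by (intro pdt_eqI) (auto intro!: derivative_eq_intros dut simp: U_def power2_eq_square)
  have w1: "pdx w x t = - 1 / ?u x t ^ 2" if "(x, t) \<in> U" for x t
    unfolding w_def using that
    by (intro pdx_eqI) (auto intro!: derivative_eq_intros dux simp: U_def power2_eq_square)
  have w2: "pdx (pdx w) x t = 2 / ?u x t ^ 3" if "(x, t) \<in> U" for x t
    using that
    by (intro pdx_eqI_on[OF U that w1]) (auto intro!: derivative_eq_intros dux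
        simp: U_def divide_simps power2_eq_square power3_eq_cube)
  have w3: "pdx (pdx (pdx w)) x t = - 6 / ?u x t ^ 4" if "(x, t) \<in> U" for x t
    using that
    by (intro pdx_eqI_on[OF U that w2]) (auto intro!: derivative_eq_intros dux
        simp: U_def divide_simps power2_eq_square power3_eq_cube power4_eq_xxxx)
  have ratio: "pdt w x t / pdx w x t = 4 / 3 * b0 * t" if "(x, t) \<in> U" for x t
    using that by (simp add: wt w1 U_def)
  have flux: "pdx (pdx (pdx w)) x t / pdx w x t
      + 3 / 2 * (((pdt w x t) ^ 2 - (pdx (pdx w) x t) ^ 2) / (pdx w x t) ^ 2)
      - 4 * ((b1 + b0 * w x t) / pdx w x t)
    = 3 / 2 * (4 / 3 * b0 * t) ^ 2 + 4 * (b1 * ?u x t ^ 2 + b0 * ?u x t)" if "(x, t) \<in> U" for x t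
  proof -
    have "?u x t \<noteq> 0" using that by (simp add: U_def)
    moreover have "w x t = 1 / ?u x t" by (simp add: w_def)
    ultimately show ?thesis
      by (simp add: wt[OF that] w1[OF that] w2[OF that] w3[OF that] divide_simps)
        (simp add: algebra_simps eval_nat_numeral)
  qed
  have T: "pdt (\<lambda>x t. pdt w x t / pdx w x t) x t = 4 / 3 * b0"
    by (rule pdt_eqI_on[OF U xt ratio]) (auto intro!: derivative_eq_intros)
  have X: "pdx (\<lambda>x t. pdx (pdx (pdx w)) x t / pdx w x t
      + 3 / 2 * (((pdt w x t) ^ 2 - (pdx (pdx w) x t) ^ 2) / (pdx w x t) ^ 2)
      - 4 * ((b1 + b0 * w x t) / pdx w x t)) x t = 4 * (2 * b1 * ?u x t + b0)"
    by (rule pdx_eqI_on[OF U xt flux]) (auto intro!: derivative_eq_intros dux)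
  show ?thesis
    unfolding w_def[symmetric] gen_sbsq_def T X by (simp add: algebra_simps)
qed

lemma not_mobius_invariant_gen_sbsq:
  fixes b0 b1 :: "'a::real_normed_field"
  assumes "b0 \<noteq> 0 \<or> b1 \<noteq> 0"
  shows "\<not> mobius_invariant (gen_sbsq b0 b1)"
proof
  assume inv: "mobius_invariant (gen_sbsq b0 b1)"
  let ?u = "travelling_parabola b0"
  define U where "U = {z. ?u (fst z) (snd z) \<noteq> 0}"
  have "open U"
    unfolding U_def travelling_parabola_def
    by (intro open_Collect_neq continuous_intros)
  moreover have "\<forall>(x, t)\<in>U. pdx ?u x t \<noteq> 0"
    by (simp add: pdx_travelling_parabola)
  moreover have "\<forall>(x, t)\<in>U. gen_sbsq b0 b1 ?u x t = 0"
    by (simp add: gen_sbsq_travelling_parabola)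
  moreover have "\<forall>(x, t)\<in>U. 1 * ?u x t + 0 \<noteq> 0"
    by (auto simp: U_def)
  moreover have "(0::'a) * 0 - 1 * 1 \<noteq> 0" by simp
  ultimately have "\<forall>(x, t)\<in>U. gen_sbsq b0 b1 (\<lambda>x t. (0 * ?u x t + 1) / (1 * ?u x t + 0)) x t = 0"
    using inv smooth_on2_travelling_parabola[of U b0] unfolding mobius_invariant_def by blast
  then have zero: "8 * b0 + 8 * b1 * ?u x t = 0" if "?u x t \<noteq> 0" for x t
    using that gen_sbsq_inverse_travelling_parabola[OF that, of b1] by (auto simp: U_def)
  \<comment> \<open>At t = 0 the parabola equals x; the two nonzero values 1 and 2 suffice to
    separate the coefficients.\<close>
  have "8 * b0 + 8 * b1 = 0" "8 * b0 + 16 * b1 = 0"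
    using zero[of 1 0] zero[of 2 0] by (simp_all add: travelling_parabola_def)
  then have "8 * b1 = 0" "b0 = - b1"
    by (algebra, metis add_eq_0_iff distrib_left mult_eq_0_iff zero_neq_numeral minus_minus)
  with assms show False by simp
qed

section \<open>The continuous limit\<close>

lemma tendsto_leading_coefficient:
  assumes "expands n f F" and low: "\<And>i. i < n \<Longrightarrow> F $ i = 0"
  shows "((\<lambda>x. f x / x ^ n) \<longlongrightarrow> F $ n) (at 0)"
proof -
  have "(\<Sum>i\<le>n. F $ i * x ^ i) = F $ n * x ^ n" for x
    using low by (simp add: lessThan_Suc_atMost[symmetric])
  with assms(1) have "((\<lambda>x. (f x - F $ n * x ^ n) / x ^ n) \<longlongrightarrow> 0) (at 0)"
    by (simp add: expands_iff_remainder)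
  from tendsto_add[OF this tendsto_const[of "F $ n"]]
  have "((\<lambda>x. (f x - F $ n * x ^ n) / x ^ n + F $ n) \<longlongrightarrow> F $ n) (at 0)" by simp
  then show ?thesis
    by (rule Lim_transform_eventually) (auto simp: eventually_at_filter field_simps)
qed

lemma fps_mult_nth_2: "(F * G) $ 2 = F $ 0 * G $ 2 + F $ 1 * G $ 1 + F $ 2 * (G::'a::comm_ring_1 fps) $ 0"
  by (simp add: fps_mult_nth numeral_2_eq_2)

lemma fps_mult_nth_3:
  "(F * G) $ 3 = F $ 0 * G $ 3 + F $ 1 * G $ 2 + F $ 2 * G $ 1 + F $ 3 * (G::'a::comm_ring_1 fps) $ 0"
  by (simp add: fps_mult_nth numeral_2_eq_2 numeral_3_eq_3)

text \<open>
  Here \<open>u\<^sub>1 - u\<^sub>0 = \<delta> A\<close>, \<open>u\<^sub>0 - u\<^sub>-\<^sub>1 = \<delta> B\<close>, \<open>P\<close>, \<open>q\<close>, \<open>R\<close> are the first and \<open>P2\<close>, \<open>2 y2\<close>, \<open>R2\<close> the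
  second derivatives of \<open>u\<^sub>1\<close>, \<open>u\<^sub>0\<close>, \<open>u\<^sub>-\<^sub>1\<close>, and \<open>C\<close> is \<open>\<delta>\<^sup>3\<close> times the lattice coefficient.
  \<open>W\<close> is the difference of the two sides of the three-point equation multiplied by its
  denominators.  The remaining variables are the partial derivatives of \<open>v\<close>, scaled so that all
  coefficients are integral.
\<close>

lemma three_point_leading_coefficient:
  fixes A B C P R P2 R2 :: "'a::field fps"
    and q v w z u s y2 y3 y4 \<beta> b0 b1 :: 'a
  assumes A: "A $ 0 = q" "A $ 1 = y2 + \<beta> * q + w" "A $ 2 = y3 + 2 * \<beta> * y2 + z"
      "A $ 3 = y4 + 3 * \<beta> * y3 + s + \<beta> ^ 2 * y2 + \<beta> * z + u"
    and B: "B $ 0 = q" "B $ 1 = - y2 + \<beta> * q + w" "B $ 2 = y3 - 2 * \<beta> * y2 - z"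
      "B $ 3 = - y4 + 3 * \<beta> * y3 + s - \<beta> ^ 2 * y2 - \<beta> * z - u"
    and P: "P $ 0 = q" "P $ 1 = 2 * y2" "P $ 2 = 3 * y3 + 2 * \<beta> * y2 + z"
      "P $ 3 = 4 * y4 + 6 * \<beta> * y3 + 2 * s"
    and R: "R $ 0 = q" "R $ 1 = - 2 * y2" "R $ 2 = 3 * y3 - 2 * \<beta> * y2 - z"
      "R $ 3 = - 4 * y4 + 6 * \<beta> * y3 + 2 * s"
    and P2: "P2 $ 0 = 2 * y2" "P2 $ 1 = 6 * y3" "P2 $ 2 = 12 * y4 + 6 * \<beta> * y3 + 2 * s"
    and R2: "R2 $ 0 = 2 * y2" "R2 $ 1 = - 6 * y3" "R2 $ 2 = 12 * y4 - 6 * \<beta> * y3 - 2 * s"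
    and C: "C $ 0 = 1" "C $ 1 = - 3 * \<beta>"
  defines "W \<equiv> C * A * B * (R * A * A - P * B * B)
    + fps_X * (A * B * (fps_const q * P2 * R + fps_const (2 * y2) * P * R + fps_const q * P * R2))
    + fps_const q * P * R * ((fps_const q - fps_const 2 * P) * B + (fps_const 2 * R - fps_const q) * A)
    + fps_X * (fps_X * ((fps_const (b1 + b0 * v) - fps_const b0 * (fps_X * B)) * A * B * (P * B - R * A)))
    - fps_X * (fps_X * (fps_X * (fps_const b0 * A * A * B * B * R)))"
  shows "W $ 0 = 0" "W $ 1 = 0" "W $ 2 = 0"
    and "W $ 3 = 6 * u * q ^ 4 + 6 * y4 * q ^ 4 - 12 * y2 * y3 * q ^ 3 - 6 * w ^ 2 * y2 * q ^ 2
      + 6 * y2 ^ 3 * q ^ 2 - b0 * q ^ 5 + 2 * (b1 + b0 * v) * y2 * q ^ 3"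
proof -
  \<comment> \<open>\<open>D\<close> starts at order 2, \<open>E\<close> and \<open>K\<close> at
    order 1, so only low coefficients of their cofactors reach order 3 of \<open>W\<close>. Since
    \<open>C\<close> occurs only in the product with \<open>D\<close>, just \<open>C $ 0\<close> and
    \<open>C $ 1\<close> reach that order: this is why both choices of P(p) lead to the same
    limit.\<close>
  define D where "D = R * A * A - P * B * B"
  define E where "E = (fps_const q - fps_const 2 * P) * B + (fps_const 2 * R - fps_const q) * A"
  define H where "H = fps_const q * P2 * R + fps_const (2 * y2) * P * R + fps_const q * P * R2"
  define K where "K = P * B - R * A"
  have pow: "x ^ 2 = x * x" "x ^ 3 = x * x * x" "x ^ 4 = x * x * x * x" "x ^ 5 = x * x * x * x * x"
    for x :: 'a by (simp_all add: eval_nat_numeral)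
  note coeffs = A B P R P2 R2 C
  note prods = fps_mult_nth_0 fps_mult_nth_1 fps_mult_nth_2 fps_mult_nth_3
  have D: "D $ 0 = 0" "D $ 1 = 0"
    by (simp_all add: D_def prods coeffs algebra_simps del: One_nat_def)
  have E: "E $ 0 = 0" "E $ 1 = - 6 * q * y2"
    by (simp_all add: E_def prods coeffs algebra_simps del: One_nat_def)
  have H: "H $ 0 = 6 * y2 * q ^ 2"
    by (simp add: H_def prods coeffs algebra_simps pow del: One_nat_def)
  have K: "K $ 0 = 0" "K $ 1 = 2 * y2 * q"
    by (simp_all add: K_def prods coeffs algebra_simps del: One_nat_def)
  have W: "W = C * A * B * D + fps_X * (A * B * H) + fps_const q * P * R * E
      + fps_X * (fps_X * ((fps_const (b1 + b0 * v) - fps_const b0 * (fps_X * B)) * A * B * K))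
      - fps_X * (fps_X * (fps_X * (fps_const b0 * A * A * B * B * R)))"
    by (simp add: W_def D_def E_def H_def K_def)
  show "W $ 0 = 0" "W $ 1 = 0"
    by (simp_all add: W prods D E H coeffs algebra_simps pow del: One_nat_def)
  have "W $ 2 = (C * A * B) $ 0 * D $ 2 + (A * B * H) $ 1 + (fps_const q * P * R) $ 0 * E $ 2
      + (fps_const q * P * R) $ 1 * E $ 1"
    by (simp add: W fps_mult_nth_2[of "C * A * B"] fps_mult_nth_2[of _ E] D E K fps_mult_nth_0 One_nat_def[symmetric]
        del: One_nat_def)
  also have "\<dots> = 0"
    unfolding D_def E_def H_def by (simp add: prods coeffs algebra_simps pow del: One_nat_def)
  finally show "W $ 2 = 0" .
  have "W $ 3 = (C * A * B) $ 0 * D $ 3 + (C * A * B) $ 1 * D $ 2 + (A * B * H) $ 2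
      + (fps_const q * P * R) $ 0 * E $ 3 + (fps_const q * P * R) $ 1 * E $ 2
      + (fps_const q * P * R) $ 2 * E $ 1
      + (b1 + b0 * v) * q ^ 2 * (2 * y2 * q) - b0 * q ^ 5"
    by (simp add: W fps_mult_nth_3[of "C * A * B"] fps_mult_nth_3[of _ E] D E K prods coeffs algebra_simps pow
        One_nat_def[symmetric] del: One_nat_def)
  also have "\<dots> = 6 * u * q ^ 4 + 6 * y4 * q ^ 4 - 12 * y2 * y3 * q ^ 3 - 6 * w ^ 2 * y2 * q ^ 2
      + 6 * y2 ^ 3 * q ^ 2 - b0 * q ^ 5 + 2 * (b1 + b0 * v) * y2 * q ^ 3"
    unfolding D_def E_def H_def by (simp add: prods coeffs algebra_simps pow del: One_nat_def)
  finally show "W $ 3 = 6 * u * q ^ 4 + 6 * y4 * q ^ 4 - 12 * y2 * y3 * q ^ 3 - 6 * w ^ 2 * y2 * q ^ 2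
      + 6 * y2 ^ 3 * q ^ 2 - b0 * q ^ 5 + 2 * (b1 + b0 * v) * y2 * q ^ 3" .
qed

lemma curve_coeff_v:
  fixes v :: "'a::real_normed_field \<Rightarrow> 'a \<Rightarrow> 'a"
  assumes U: "open U" "(\<xi>, \<tau>) \<in> U" and v: "smooth_on2 U v"
  shows "curve_coeff \<sigma> \<beta> \<gamma> \<xi> \<tau> v 2 =
      \<sigma> ^ 2 * pdx (pdx v) \<xi> \<tau> / 2 + \<beta> * pdx v \<xi> \<tau> + \<gamma> * pdt v \<xi> \<tau>"
    and "curve_coeff \<sigma> \<beta> \<gamma> \<xi> \<tau> v 3 =
      \<sigma> ^ 3 * pdx (pdx (pdx v)) \<xi> \<tau> / 6
      + \<sigma> * (\<beta> * pdx (pdx v) \<xi> \<tau> + \<gamma> * pdt (pdx v) \<xi> \<tau>)"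
    and "curve_coeff \<sigma> \<beta> \<gamma> \<xi> \<tau> v 4 =
      \<sigma> ^ 4 * pdx (pdx (pdx (pdx v))) \<xi> \<tau> / 24
      + \<sigma> ^ 2 * (\<beta> * pdx (pdx (pdx v)) \<xi> \<tau> + \<gamma> * pdt (pdx (pdx v)) \<xi> \<tau>) / 2
      + \<beta> ^ 2 * pdx (pdx v) \<xi> \<tau> / 2 + \<beta> * \<gamma> * pdt (pdx v) \<xi> \<tau>
      + \<gamma> ^ 2 * pdt (pdt v) \<xi> \<tau> / 2"
proof -
  have comm: "pdx (pdt g) \<xi> \<tau> = pdt (pdx g) \<xi> \<tau>" if "smooth_on2 U g" for g
    using smooth_on2_partials_commute[OF U that] by simp
  \<comment> \<open>Below the outer \<open>pdx\<close> the two functions have to agree near the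
    point, so commutation is applied at every point of U.\<close>
  have "pdx (pdx (pdt v)) \<xi> \<tau> = pdx (pdt (pdx v)) \<xi> \<tau>"
    by (rule pdx_cong[OF U]) (simp add: smooth_on2_partials_commute[OF U(1) _ v])
  then have comm2: "pdx (pdx (pdt v)) \<xi> \<tau> = pdt (pdx (pdx v)) \<xi> \<tau>"
    by (simp add: comm smooth_on2_pdx v)
  note [simp] = comm[OF v] comm[OF smooth_on2_pdx[OF v]] comm2
  show "curve_coeff \<sigma> \<beta> \<gamma> \<xi> \<tau> v 2 =
      \<sigma> ^ 2 * pdx (pdx v) \<xi> \<tau> / 2 + \<beta> * pdx v \<xi> \<tau> + \<gamma> * pdt v \<xi> \<tau>"
    by (simp add: numeral_2_eq_2 field_simps)
  show "curve_coeff \<sigma> \<beta> \<gamma> \<xi> \<tau> v 3 =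
      \<sigma> ^ 3 * pdx (pdx (pdx v)) \<xi> \<tau> / 6
      + \<sigma> * (\<beta> * pdx (pdx v) \<xi> \<tau> + \<gamma> * pdt (pdx v) \<xi> \<tau>)"
    by (simp add: eval_nat_numeral divide_simps) (simp add: algebra_simps)
  show "curve_coeff \<sigma> \<beta> \<gamma> \<xi> \<tau> v 4 =
      \<sigma> ^ 4 * pdx (pdx (pdx (pdx v))) \<xi> \<tau> / 24
      + \<sigma> ^ 2 * (\<beta> * pdx (pdx (pdx v)) \<xi> \<tau> + \<gamma> * pdt (pdx (pdx v)) \<xi> \<tau>) / 2
      + \<beta> ^ 2 * pdx (pdx v) \<xi> \<tau> / 2 + \<beta> * \<gamma> * pdt (pdx v) \<xi> \<tau>
      + \<gamma> ^ 2 * pdt (pdt v) \<xi> \<tau> / 2"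
    by (simp add: eval_nat_numeral divide_simps) (simp add: algebra_simps)
qed

text \<open>Brings the target to the variables of the order 3 coefficient of W. The mixed derivative
  v_xt disappears: 3 \<partial>_t (v_t / v_x) contributes -3 v_t v_xt / v_x^2, and 3/2 \<partial>_x
  (v_t^2 / v_x^2) contributes the opposite.\<close>

lemma gen_sbsq_expanded:
  fixes v :: "'a::real_normed_field \<Rightarrow> 'a \<Rightarrow> 'a"
  assumes U: "open U" "(x, t) \<in> U" and v: "smooth_on2 U v"
    and vx: "\<And>x t. (x, t) \<in> U \<Longrightarrow> pdx v x t \<noteq> 0"
  defines "q \<equiv> pdx v x t" and "y2 \<equiv> pdx (pdx v) x t / 2" and "y3 \<equiv> pdx (pdx (pdx v)) x t / 6"
    and "y4 \<equiv> pdx (pdx (pdx (pdx v))) x t / 24" and "w \<equiv> pdt v x t / 2" and "u \<equiv> pdt (pdt v) x t / 8"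
  shows "q ^ 5 * gen_sbsq b0 b1 v x t / 4 =
      6 * u * q ^ 4 + 6 * y4 * q ^ 4 - 12 * y2 * y3 * q ^ 3 - 6 * w ^ 2 * y2 * q ^ 2
      + 6 * y2 ^ 3 * q ^ 2 - b0 * q ^ 5 + 2 * (b1 + b0 * v x t) * y2 * q ^ 3"
proof -
  note v1 = smooth_on2_pdx[OF v] and v2 = smooth_on2_pdx[OF smooth_on2_pdx[OF v]]
  note dx = smooth_on2_DERIV_x[OF v U(2)] smooth_on2_DERIV_x[OF v1 U(2)] smooth_on2_DERIV_x[OF v2 U(2)]
    smooth_on2_DERIV_x[OF smooth_on2_pdx[OF v2] U(2)]
    smooth_on2_DERIV_x[OF smooth_on2_pdt[OF v] U(2)]
  note dt = smooth_on2_DERIV_t[OF v1 U(2)] smooth_on2_DERIV_t[OF smooth_on2_pdt[OF v] U(2)]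
  note comm = smooth_on2_partials_commute[OF U v]
  have q: "q \<noteq> 0" using vx[OF U(2)] by (simp add: q_def)
  have T: "pdt (\<lambda>x t. pdt v x t / pdx v x t) x t =
      (pdt (pdt v) x t * q - pdt v x t * pdt (pdx v) x t) / (q * q)"
    using vx[OF U(2)] unfolding q_def
    by (intro pdt_eqI) (auto intro!: derivative_eq_intros dt)
  have X: "pdx (\<lambda>x t. pdx (pdx (pdx v)) x t / pdx v x t
      + 3 / 2 * (((pdt v x t) ^ 2 - (pdx (pdx v) x t) ^ 2) / (pdx v x t) ^ 2)
      - 4 * ((b1 + b0 * v x t) / pdx v x t)) x t =
     (pdx (pdx (pdx (pdx v))) x t * q - pdx (pdx (pdx v)) x t * pdx (pdx v) x t) / (q * q)
     + 3 / 2 * (((2 * pdt v x t * pdt (pdx v) x t - 2 * pdx (pdx v) x t * pdx (pdx (pdx v)) x t) * q ^ 2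
         - ((pdt v x t) ^ 2 - (pdx (pdx v) x t) ^ 2) * (2 * q * pdx (pdx v) x t)) / (q ^ 2 * q ^ 2))
     - 4 * ((b0 * q * q - (b1 + b0 * v x t) * pdx (pdx v) x t) / (q * q))"
    using vx[OF U(2)] unfolding q_def comm
    by (intro pdx_eqI)
      (auto intro!: derivative_eq_intros dx, simp add: divide_simps, simp add: algebra_simps eval_nat_numeral)
  show ?thesis
    unfolding gen_sbsq_def T X y2_def y3_def y4_def w_def u_def using q
    by (simp add: divide_simps) (simp add: algebra_simps eval_nat_numeral)
qed

section \<open>From the lattice equation to its polynomial form\<close>

text \<open>Origin of the quadratic curve: a step \<nu> \<delta> in y is multiplied by 1 - \<alpha>2
  \<delta> / 3 in the x-direction and by \<delta> / 2 in the t-direction. The position y itself is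
  eliminated in favour of \<xi> and \<tau>.\<close>

lemma lattice_shift_eq:
  assumes "new_x \<alpha>2 \<delta> y X = \<xi>" "new_t \<delta> y = \<tau>"
  shows "lattice_shift \<alpha>2 \<delta> v y \<nu> x =
    v (x + (\<xi> - X + of_int \<nu> * (\<delta> - \<alpha>2 / 3 * \<delta> ^ 2))) (\<tau> + of_int \<nu> / 2 * \<delta> ^ 2)"
proof -
  have "new_x \<alpha>2 \<delta> (y + of_int \<nu> * \<delta>) x
      = x + (new_x \<alpha>2 \<delta> y X - X + of_int \<nu> * (\<delta> - \<alpha>2 / 3 * \<delta> ^ 2))"
    "new_t \<delta> (y + of_int \<nu> * \<delta>) = new_t \<delta> y + of_int \<nu> / 2 * \<delta> ^ 2"
    by (simp_all add: new_x_def new_t_def algebra_simps power2_eq_square)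
  then show ?thesis
    using assms by (simp add: lattice_shift_def in_old_coords_def)
qed

text \<open>The expression under the logarithm contains \<open>deriv (u \<nu>)\<close> and is
  differentiated once more, hence first derivatives are given near \<open>X\<close> and second
  derivatives at \<open>X\<close> itself.\<close>

lemma three_point_lhs_eq:
  fixes u d e :: "int \<Rightarrow> 'a::real_normed_field \<Rightarrow> 'a"
  assumes u_DERIV: "\<forall>\<nu>\<in>{- 1, 0, 1}. \<forall>\<^sub>F x in nhds X. (u \<nu> has_field_derivative d \<nu> x) (at x)"
    and d_DERIV: "\<forall>\<nu>\<in>{- 1, 0, 1}. (d \<nu> has_field_derivative e \<nu> X) (at X)"
    and nz: "u 1 X - u 0 X \<noteq> 0" "u 0 X - u (- 1) X \<noteq> 0"
  shows "three_point_lhs c b0 b1 u X =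
    (c * (d 1 X - d (- 1) X) - b0 * d (- 1) X
      + ((e 1 X * d 0 X * d (- 1) X + d 1 X * e 0 X * d (- 1) X + d 1 X * d 0 X * e (- 1) X)
            * ((u 1 X - u 0 X) * (u 0 X - u (- 1) X))
          - d 1 X * d 0 X * d (- 1) X
            * ((d 1 X - d 0 X) * (u 0 X - u (- 1) X) + (u 1 X - u 0 X) * (d 0 X - d (- 1) X)))
        / ((u 1 X - u 0 X) * (u 0 X - u (- 1) X)) ^ 2)
    / (c * (u 1 X - u (- 1) X) - b1 - b0 * u (- 1) X
      + d 1 X * d 0 X * d (- 1) X / ((u 1 X - u 0 X) * (u 0 X - u (- 1) X)))"
    and "three_point_rhs u X = d 1 X / (u 1 X - u 0 X) - d (- 1) X / (u 0 X - u (- 1) X)"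
proof -
  note u = u_DERIV[rule_format] and d = d_DERIV[rule_format]
  let ?f = "\<lambda>d x. c * (u 1 x - u (- 1) x) - b1 - b0 * u (- 1) x
      + d 1 x * d 0 x * d (- 1) x / ((u 1 x - u 0 x) * (u 0 x - u (- 1) x))"
  have du: "\<forall>\<^sub>F x in nhds X. deriv (u \<nu>) x = d \<nu> x" if "\<nu> \<in> {- 1, 0, 1}" for \<nu>
    using u[OF that] by eventually_elim (rule DERIV_imp_deriv)
  have du': "deriv (u \<nu>) X = d \<nu> X" "(u \<nu> has_field_derivative d \<nu> X) (at X)" if "\<nu> \<in> {- 1, 0, 1}" for \<nu>
    using eventually_nhds_x_imp_x[OF du[OF that]] eventually_nhds_x_imp_x[OF u[OF that]] by auto
  have "\<forall>\<^sub>F x in nhds X. ?f (\<lambda>\<nu>. deriv (u \<nu>)) x = ?f d x"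
    using du[of 1, simplified] du[of 0, simplified] du[of "- 1", simplified] by eventually_elim simp
  then have "deriv (?f (\<lambda>\<nu>. deriv (u \<nu>))) X = deriv (?f d) X"
    by (rule deriv_cong_ev) simp
  also have "\<dots> = c * (d 1 X - d (- 1) X) - b0 * d (- 1) X
      + ((e 1 X * d 0 X * d (- 1) X + d 1 X * e 0 X * d (- 1) X + d 1 X * d 0 X * e (- 1) X)
            * ((u 1 X - u 0 X) * (u 0 X - u (- 1) X))
          - d 1 X * d 0 X * d (- 1) X
            * ((d 1 X - d 0 X) * (u 0 X - u (- 1) X) + (u 1 X - u 0 X) * (d 0 X - d (- 1) X)))
        / ((u 1 X - u 0 X) * (u 0 X - u (- 1) X)) ^ 2"
    using nz
    by (intro DERIV_imp_deriv)
      (auto intro!: derivative_eq_intros d du'(2), simp add: power2_eq_square, simp add: algebra_simps)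
  finally show "three_point_lhs c b0 b1 u X =
    (c * (d 1 X - d (- 1) X) - b0 * d (- 1) X
      + ((e 1 X * d 0 X * d (- 1) X + d 1 X * e 0 X * d (- 1) X + d 1 X * d 0 X * e (- 1) X)
            * ((u 1 X - u 0 X) * (u 0 X - u (- 1) X))
          - d 1 X * d 0 X * d (- 1) X
            * ((d 1 X - d 0 X) * (u 0 X - u (- 1) X) + (u 1 X - u 0 X) * (d 0 X - d (- 1) X)))
        / ((u 1 X - u 0 X) * (u 0 X - u (- 1) X)) ^ 2)
    / (c * (u 1 X - u (- 1) X) - b1 - b0 * u (- 1) X
      + d 1 X * d 0 X * d (- 1) X / ((u 1 X - u 0 X) * (u 0 X - u (- 1) X)))"
    unfolding three_point_lhs_def dlog_def by (simp add: du')
  show "three_point_rhs u X = d 1 X / (u 1 X - u 0 X) - d (- 1) X / (u 0 X - u (- 1) X)"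
    unfolding three_point_rhs_def by (simp add: du')
qed

text \<open>A field identity that collects the powers of \<delta>. \<open>S\<close> is \<delta>^2
  times the bracket under the logarithm, so the two sides of the equation differ by W / (\<delta> (A
  B)^2 S). With W of order \<delta>^3 this is of order \<delta>^2, which explains the
  normalisation.\<close>

lemma three_point_scaled_difference:
  fixes A B C p q r p2 q2 r2 b0 b1 V \<delta> :: "'a::field"
  assumes nz: "\<delta> \<noteq> 0" "A \<noteq> 0" "B \<noteq> 0"
  defines "S \<equiv> C * (A + B) - \<delta> ^ 2 * (b1 + b0 * (V - \<delta> * B)) + p * q * r / (A * B)"
  defines "W \<equiv> C * A * B * (r * A * A - p * B * B)
    + \<delta> * (A * B * (q * p2 * r + q2 * p * r + q * p * r2))
    + q * p * r * ((q - 2 * p) * B + (2 * r - q) * A)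
    + \<delta> * (\<delta> * ((b1 + b0 * V - b0 * (\<delta> * B)) * A * B * (p * B - r * A)))
    - \<delta> * (\<delta> * (\<delta> * (b0 * A * A * B * B * r)))"
  assumes S: "S \<noteq> 0"
  shows "((C / \<delta> ^ 3 * (p - r) - b0 * r
      + ((p2 * q * r + p * q2 * r + p * q * r2) * (\<delta> * A * (\<delta> * B))
          - p * q * r * ((p - q) * (\<delta> * B) + (\<delta> * A) * (q - r)))
        / (\<delta> * A * (\<delta> * B)) ^ 2)
    / (C / \<delta> ^ 3 * (\<delta> * A + \<delta> * B) - b1 - b0 * (V - \<delta> * B) + p * q * r / (\<delta> * A * (\<delta> * B)))
    - (p / (\<delta> * A) - r / (\<delta> * B))) / \<delta> ^ 2 = W / \<delta> ^ 3 / ((A * B) ^ 2 * S)"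
    (is "(?N' / ?N - ?R) / _ = _")
proof -
  have N: "?N = S / \<delta> ^ 2"
    unfolding S_def using nz by (simp add: divide_simps) (simp add: algebra_simps eval_nat_numeral)
  have "\<delta> ^ 2 * ?N' - ?R * S = W / (\<delta> * (A * B) ^ 2)"
    unfolding S_def W_def using nz
    by (simp add: divide_simps) (simp add: algebra_simps eval_nat_numeral)
  \<comment> \<open>Stated for arbitrary field elements so that the large expressions stay atomic
    during simplification.\<close>
  moreover have "n / (S / d) - R = K / S" if "d * n - R * S = K" "d \<noteq> 0" for n d R K :: 'a
    using that S by (simp add: field_simps)
  ultimately have "?N' / ?N - ?R = W / (\<delta> * (A * B) ^ 2) / S"
    unfolding N using nz by simp
  then show ?thesis
    by (simp add: eval_nat_numeral mult_ac)
qed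

lemma eventually_curve_in_open:
  fixes U :: "('a::real_normed_field \<times> 'a) set"
  assumes "open U" "(\<xi>, \<tau>) \<in> U"
  shows "\<forall>\<^sub>F \<delta> in at 0. (\<xi> + \<sigma> * \<delta> + \<beta> * \<delta> ^ 2, \<tau> + \<gamma> * \<delta> ^ 2) \<in> U"
proof -
  have "isCont (\<lambda>\<delta>. (\<xi> + \<sigma> * \<delta> + \<beta> * \<delta> ^ 2, \<tau> + \<gamma> * \<delta> ^ 2)) 0"
    by (intro continuous_intros)
  then have "((\<lambda>\<delta>. (\<xi> + \<sigma> * \<delta> + \<beta> * \<delta> ^ 2, \<tau> + \<gamma> * \<delta> ^ 2)) \<longlongrightarrow> (\<xi>, \<tau>)) (at 0)"
    by (simp add: isCont_def)
  then show ?thesis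
    by (rule topological_tendstoD) (use assms in simp_all)
qed

lemma smooth_on2_shifted_DERIV:
  fixes g :: "'a::real_normed_field \<Rightarrow> 'a \<Rightarrow> 'a"
  assumes "open U" "smooth_on2 U g" "(x + c, t) \<in> U"
  shows "((\<lambda>x. g (x + c) t) has_field_derivative pdx g (x + c) t) (at x)"
proof -
  have "((\<lambda>x. x + c) has_field_derivative 1) (at x)"
    by (auto intro!: derivative_eq_intros)
  from smooth_on2_chain[OF assms this DERIV_const] show ?thesis by simp
qed

lemma three_point_limit:
  fixes v :: "'a::real_normed_field \<Rightarrow> 'a \<Rightarrow> 'a"
  assumes U: "open U" "(\<xi>, \<tau>) \<in> U" and v: "smooth_on2 U v"
    and vx: "\<And>x t. (x, t) \<in> U \<Longrightarrow> pdx v x t \<noteq> 0"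
    and coords: "\<And>\<delta>. \<delta> \<noteq> 0 \<Longrightarrow> new_x \<alpha>2 \<delta> (Y \<delta>) (X \<delta>) = \<xi>" "\<And>\<delta>. \<delta> \<noteq> 0 \<Longrightarrow> new_t \<delta> (Y \<delta>) = \<tau>"
    and P: "\<And>\<delta>. \<delta> \<noteq> 0 \<Longrightarrow>
      P (1 / \<delta>) = (1 + \<alpha>2 * \<delta> + \<alpha>1 * (\<delta> * \<delta>) + \<kappa> * (\<delta> * (\<delta> * \<delta>))) / \<delta> ^ 3"
  shows "((\<lambda>\<delta>. (three_point_lhs (P (1 / \<delta>)) b0 b1 (lattice_shift \<alpha>2 \<delta> v (Y \<delta>)) (X \<delta>)
                - three_point_rhs (lattice_shift \<alpha>2 \<delta> v (Y \<delta>)) (X \<delta>)) / \<delta> ^ 2)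
          \<longlongrightarrow> gen_sbsq b0 b1 v \<xi> \<tau> / 12) (at 0)"
proof -
  define \<beta> where "\<beta> = - \<alpha>2 / 3"
  define plus where "plus g \<delta> = g (\<xi> + 1 * \<delta> + \<beta> * \<delta> ^ 2) (\<tau> + 1 / 2 * \<delta> ^ 2)"
    for g :: "'a \<Rightarrow> 'a \<Rightarrow> 'a" and \<delta>
  define minus where "minus g \<delta> = g (\<xi> + - 1 * \<delta> + - \<beta> * \<delta> ^ 2) (\<tau> + - (1 / 2) * \<delta> ^ 2)"
    for g :: "'a \<Rightarrow> 'a \<Rightarrow> 'a" and \<delta>
  define Fp where "Fp g = Abs_fps (curve_coeff 1 \<beta> (1 / 2) \<xi> \<tau> g)" for g
  define Fm where "Fm g = Abs_fps (curve_coeff (- 1) (- \<beta>) (- (1 / 2)) \<xi> \<tau> g)" for g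
  have plus: "expands n (plus g) (Fp g)" if "smooth_on2 U g" for n g
    unfolding plus_def[abs_def] Fp_def by (rule expands_along_curve[OF U that])
  have minus: "expands n (minus g) (Fm g)" if "smooth_on2 U g" for n g
    unfolding minus_def[abs_def] Fm_def by (rule expands_along_curve[OF U that])
  note v1 = smooth_on2_pdx[OF v] and v2 = smooth_on2_pdx[OF smooth_on2_pdx[OF v]]

  define V where "V = v \<xi> \<tau>"
  define A where "A \<delta> = (plus v \<delta> - V) / \<delta>" for \<delta>
  define B where "B \<delta> = - ((minus v \<delta> - V) / \<delta>)" for \<delta>
  define C where "C \<delta> = 1 + \<alpha>2 * \<delta> + \<alpha>1 * (\<delta> * \<delta>) + \<kappa> * (\<delta> * (\<delta> * \<delta>))" for \<delta>
  define p where "p = plus (pdx v)"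
  define r where "r = minus (pdx v)"
  define p2 where "p2 = plus (pdx (pdx v))"
  define r2 where "r2 = minus (pdx (pdx v))"
  define q where "q = pdx v \<xi> \<tau>"
  define y2 where "y2 = pdx (pdx v) \<xi> \<tau> / 2"
  define y3 where "y3 = pdx (pdx (pdx v)) \<xi> \<tau> / 6"
  define y4 where "y4 = pdx (pdx (pdx (pdx v))) \<xi> \<tau> / 24"
  define w where "w = pdt v \<xi> \<tau> / 2"
  define z where "z = pdt (pdx v) \<xi> \<tau> / 2"
  define s where "s = pdt (pdx (pdx v)) \<xi> \<tau> / 4"
  define u where "u = pdt (pdt v) \<xi> \<tau> / 8"
  have q: "q \<noteq> 0" using vx[OF U(2)] by (simp add: q_def)

  define FA where "FA = fps_shift 1 (Fp v)"
  define FB where "FB = - fps_shift 1 (Fm v)"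
  define FC where "FC = 1 + fps_const \<alpha>2 * fps_X + fps_const \<alpha>1 * (fps_X * fps_X)
    + fps_const \<kappa> * (fps_X * (fps_X * fps_X))"
  have F0: "Fp v $ 0 = V" "Fm v $ 0 = V"
    by (simp_all add: Fp_def Fm_def V_def)
  \<comment> \<open>Order \<open>Suc 3\<close> for v, because a difference quotient loses one
    order.\<close>
  have A: "expands 3 A FA"
    using plus[OF v, of "Suc 3"] unfolding expands.simps F0 by (simp add: A_def[abs_def] FA_def)
  have B: "expands 3 B FB"
    using expands_minus[OF minus[OF v, of "Suc 3", unfolded expands.simps F0]]
    by (simp add: B_def[abs_def] FB_def)
  have C: "expands 3 C FC"
    unfolding C_def[abs_def] FC_def fps_const_1_eq_1[symmetric]
    by (intro expands_add expands_mult expands_const expands_X)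
  have p: "expands 3 p (Fp (pdx v))" and r: "expands 3 r (Fm (pdx v))"
    and p2: "expands 3 p2 (Fp (pdx (pdx v)))" and r2: "expands 3 r2 (Fm (pdx (pdx v)))"
    unfolding p_def r_def p2_def r2_def by (intro plus minus v1 v2)+

  define W where "W \<delta> = C \<delta> * A \<delta> * B \<delta> * (r \<delta> * A \<delta> * A \<delta> - p \<delta> * B \<delta> * B \<delta>)
    + \<delta> * (A \<delta> * B \<delta> * (q * p2 \<delta> * r \<delta> + (2 * y2) * p \<delta> * r \<delta> + q * p \<delta> * r2 \<delta>))
    + q * p \<delta> * r \<delta> * ((q - 2 * p \<delta>) * B \<delta> + (2 * r \<delta> - q) * A \<delta>)
    + \<delta> * (\<delta> * ((b1 + b0 * V - b0 * (\<delta> * B \<delta>)) * A \<delta> * B \<delta> * (p \<delta> * B \<delta> - r \<delta> * A \<delta>)))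
    - \<delta> * (\<delta> * (\<delta> * (b0 * A \<delta> * A \<delta> * B \<delta> * B \<delta> * r \<delta>)))" for \<delta>
  define S where "S \<delta> = C \<delta> * (A \<delta> + B \<delta>) - \<delta> ^ 2 * (b1 + b0 * (V - \<delta> * B \<delta>))
    + p \<delta> * q * r \<delta> / (A \<delta> * B \<delta>)" for \<delta>

  note cc = curve_coeff_v[OF U v] curve_coeff_v[OF U v1] curve_coeff_v[OF U v2]
  note vars = q_def y2_def y3_def y4_def w_def z_def s_def u_def
  have coeffs:
    "FA $ 0 = q" "FA $ 1 = y2 + \<beta> * q + w" "FA $ 2 = y3 + 2 * \<beta> * y2 + z"
    "FA $ 3 = y4 + 3 * \<beta> * y3 + s + \<beta> ^ 2 * y2 + \<beta> * z + u"
    "FB $ 0 = q" "FB $ 1 = - y2 + \<beta> * q + w" "FB $ 2 = y3 - 2 * \<beta> * y2 - z"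
    "FB $ 3 = - y4 + 3 * \<beta> * y3 + s - \<beta> ^ 2 * y2 - \<beta> * z - u"
    "Fp (pdx v) $ 0 = q" "Fp (pdx v) $ 1 = 2 * y2" "Fp (pdx v) $ 2 = 3 * y3 + 2 * \<beta> * y2 + z"
    "Fp (pdx v) $ 3 = 4 * y4 + 6 * \<beta> * y3 + 2 * s"
    "Fm (pdx v) $ 0 = q" "Fm (pdx v) $ 1 = - 2 * y2" "Fm (pdx v) $ 2 = 3 * y3 - 2 * \<beta> * y2 - z"
    "Fm (pdx v) $ 3 = - 4 * y4 + 6 * \<beta> * y3 + 2 * s"
    "Fp (pdx (pdx v)) $ 0 = 2 * y2" "Fp (pdx (pdx v)) $ 1 = 6 * y3"
    "Fp (pdx (pdx v)) $ 2 = 12 * y4 + 6 * \<beta> * y3 + 2 * s"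
    "Fm (pdx (pdx v)) $ 0 = 2 * y2" "Fm (pdx (pdx v)) $ 1 = - 6 * y3"
    "Fm (pdx (pdx v)) $ 2 = 12 * y4 - 6 * \<beta> * y3 - 2 * s"
    "FC $ 0 = 1" "FC $ 1 = - 3 * \<beta>"
    by (simp_all add: FA_def FB_def FC_def Fp_def Fm_def cc vars \<beta>_def
        smooth_on2_partials_commute[OF U v] field_simps)
  define FW where "FW = FC * FA * FB * (Fm (pdx v) * FA * FA - Fp (pdx v) * FB * FB)
    + fps_X * (FA * FB * (fps_const q * Fp (pdx (pdx v)) * Fm (pdx v)
        + fps_const (2 * y2) * Fp (pdx v) * Fm (pdx v) + fps_const q * Fp (pdx v) * Fm (pdx (pdx v))))
    + fps_const q * Fp (pdx v) * Fm (pdx v)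
      * ((fps_const q - fps_const 2 * Fp (pdx v)) * FB + (fps_const 2 * Fm (pdx v) - fps_const q) * FA)
    + fps_X * (fps_X * ((fps_const (b1 + b0 * V) - fps_const b0 * (fps_X * FB)) * FA * FB
        * (Fp (pdx v) * FB - Fm (pdx v) * FA)))
    - fps_X * (fps_X * (fps_X * (fps_const b0 * FA * FA * FB * FB * Fm (pdx v))))"
  have "expands 3 W FW"
    unfolding W_def[abs_def] FW_def
    by (intro expands_add expands_diff expands_mult expands_const expands_X A B C p r p2 r2)
  moreover note FW = three_point_leading_coefficient[OF coeffs, of b1 b0 V, folded FW_def]
  have "FW $ i = 0" if "i < 3" for i
    using that FW(1-3) by (auto simp: less_Suc_eq numeral_3_eq_3 numeral_2_eq_2)
  ultimately have "((\<lambda>\<delta>. W \<delta> / \<delta> ^ 3) \<longlongrightarrow> FW $ 3) (at 0)"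
    by (rule tendsto_leading_coefficient)
  moreover have "FW $ 3 = q ^ 5 * gen_sbsq b0 b1 v \<xi> \<tau> / 4"
    using gen_sbsq_expanded[OF U v vx, of b0 b1] unfolding FW(4) vars V_def by simp
  ultimately have W_lim: "((\<lambda>\<delta>. W \<delta> / \<delta> ^ 3) \<longlongrightarrow> q ^ 5 * gen_sbsq b0 b1 v \<xi> \<tau> / 4) (at 0)"
    by simp

  note lims = expands_tendsto[OF A, unfolded coeffs] expands_tendsto[OF B, unfolded coeffs]
    expands_tendsto[OF C, unfolded coeffs] expands_tendsto[OF p, unfolded coeffs]
    expands_tendsto[OF r, unfolded coeffs]
  \<comment> \<open>C (A + B) contributes 2 q and the product of the three first derivatives over A
    B contributes q.\<close>
  have S_lim: "(S \<longlongrightarrow> 3 * q) (at 0)"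
  proof -
    have "(S \<longlongrightarrow> 1 * (q + q) - 0 ^ 2 * (b1 + b0 * (V - 0 * q)) + q * q * q / (q * q)) (at 0)"
      unfolding S_def[abs_def] by (intro tendsto_intros lims) (use q in simp)
    then show ?thesis using q by simp
  qed
  have "((\<lambda>\<delta>. W \<delta> / \<delta> ^ 3 / ((A \<delta> * B \<delta>) ^ 2 * S \<delta>))
      \<longlongrightarrow> q ^ 5 * gen_sbsq b0 b1 v \<xi> \<tau> / 4 / ((q * q) ^ 2 * (3 * q))) (at 0)"
    by (intro tendsto_intros lims W_lim S_lim) (use q in simp)
  moreover have "q ^ 5 * gen_sbsq b0 b1 v \<xi> \<tau> / 4 / ((q * q) ^ 2 * (3 * q)) = gen_sbsq b0 b1 v \<xi> \<tau> / 12"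
    using q by (simp add: divide_simps) (simp add: eval_nat_numeral)
  ultimately have lim: "((\<lambda>\<delta>. W \<delta> / \<delta> ^ 3 / ((A \<delta> * B \<delta>) ^ 2 * S \<delta>))
      \<longlongrightarrow> gen_sbsq b0 b1 v \<xi> \<tau> / 12) (at 0)"
    by (simp only:)

  \<comment> \<open>For all small nonzero \<delta> the quotient with the known limit is exactly the
    normalised difference of the two sides. The collected conditions keep the denominators nonzero
    and both outer lattice points inside U.\<close>
  have "\<forall>\<^sub>F \<delta> in at 0. \<delta> \<noteq> (0::'a)"
    by (simp add: eventually_at_filter)
  moreover have "\<forall>\<^sub>F \<delta> in at 0. A \<delta> \<noteq> 0" "\<forall>\<^sub>F \<delta> in at 0. B \<delta> \<noteq> 0" "\<forall>\<^sub>F \<delta> in at 0. S \<delta> \<noteq> 0"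
    using tendsto_imp_eventually_ne[OF lims(1) q] tendsto_imp_eventually_ne[OF lims(2) q]
      tendsto_imp_eventually_ne[OF S_lim] q by simp_all
  moreover note eventually_curve_in_open[OF U, of 1 \<beta> "1 / 2"]
    eventually_curve_in_open[OF U, of "- 1" "- \<beta>" "- (1 / 2)"]
  ultimately have "\<forall>\<^sub>F \<delta> in at 0. W \<delta> / \<delta> ^ 3 / ((A \<delta> * B \<delta>) ^ 2 * S \<delta>)
    = (three_point_lhs (P (1 / \<delta>)) b0 b1 (lattice_shift \<alpha>2 \<delta> v (Y \<delta>)) (X \<delta>)
                - three_point_rhs (lattice_shift \<alpha>2 \<delta> v (Y \<delta>)) (X \<delta>)) / \<delta> ^ 2"
  proof eventually_elim
    case (elim \<delta>)
    define \<phi> where "\<phi> = lattice_shift \<alpha>2 \<delta> v (Y \<delta>)"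
    define c where "c \<nu> = \<xi> - X \<delta> + of_int \<nu> * (\<delta> - \<alpha>2 / 3 * \<delta> ^ 2)" for \<nu>
    define h where "h \<nu> = \<tau> + of_int \<nu> / 2 * \<delta> ^ 2" for \<nu>
    have \<phi>: "\<phi> \<nu> = (\<lambda>x. v (x + c \<nu>) (h \<nu>))" for \<nu>
      unfolding \<phi>_def c_def h_def fun_eq_iff
      using lattice_shift_eq[OF coords] elim(1) by blast
    have plus_pt: "X \<delta> + c 1 = \<xi> + 1 * \<delta> + \<beta> * \<delta> ^ 2" "h 1 = \<tau> + 1 / 2 * \<delta> ^ 2"
      by (simp_all add: c_def h_def \<beta>_def)
    have minus_pt: "X \<delta> + c (- 1) = \<xi> + - 1 * \<delta> + - \<beta> * \<delta> ^ 2" "h (- 1) = \<tau> + - (1 / 2) * \<delta> ^ 2"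
      by (simp_all add: c_def h_def \<beta>_def)
    have zero_pt: "X \<delta> + c 0 = \<xi>" "h 0 = \<tau>"
      by (simp_all add: c_def h_def)
    have mem: "(X \<delta> + c \<nu>, h \<nu>) \<in> U" if "\<nu> \<in> {- 1, 0, 1}" for \<nu>
      using that elim(5,6) U(2) by (auto simp only: plus_pt minus_pt zero_pt insert_iff empty_iff)
    have "\<forall>\<^sub>F x in nhds (X \<delta>). (\<phi> \<nu> has_field_derivative pdx v (x + c \<nu>) (h \<nu>)) (at x)"
      if "\<nu> \<in> {- 1, 0, 1}" for \<nu>
    proof -
      have "((\<lambda>x. x + c \<nu>) \<longlongrightarrow> X \<delta> + c \<nu>) (nhds (X \<delta>))"
        by (intro tendsto_add tendsto_const filterlim_ident)
      then have "\<forall>\<^sub>F x in nhds (X \<delta>). (x + c \<nu>, h \<nu>) \<in> U"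
        using open_slice_eventually(1)[OF U(1) mem[OF that]] unfolding filterlim_iff by blast
      then show ?thesis
        by eventually_elim (simp add: \<phi> smooth_on2_shifted_DERIV[OF U(1) v])
    qed
    then have d: "\<forall>\<nu>\<in>{- 1, 0, 1}. \<forall>\<^sub>F x in nhds (X \<delta>).
        (\<phi> \<nu> has_field_derivative pdx v (x + c \<nu>) (h \<nu>)) (at x)" by blast
    have "((\<lambda>x. pdx v (x + c \<nu>) (h \<nu>)) has_field_derivative
        pdx (pdx v) (X \<delta> + c \<nu>) (h \<nu>)) (at (X \<delta>))" if "\<nu> \<in> {- 1, 0, 1}" for \<nu>
      by (rule smooth_on2_shifted_DERIV[OF U(1) v1 mem[OF that]])
    then have e: "\<forall>\<nu>\<in>{- 1, 0, 1}. ((\<lambda>x. pdx v (x + c \<nu>) (h \<nu>)) has_field_derivative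
        pdx (pdx v) (X \<delta> + c \<nu>) (h \<nu>)) (at (X \<delta>))" by blast
    have vals: "\<phi> 1 (X \<delta>) = plus v \<delta>" "\<phi> 0 (X \<delta>) = V" "\<phi> (- 1) (X \<delta>) = minus v \<delta>"
      unfolding \<phi> plus_pt minus_pt zero_pt by (simp_all only: plus_def minus_def V_def)
    have diffs: "\<phi> 1 (X \<delta>) - \<phi> 0 (X \<delta>) = \<delta> * A \<delta>" "\<phi> 0 (X \<delta>) - \<phi> (- 1) (X \<delta>) = \<delta> * B \<delta>"
      "\<phi> 1 (X \<delta>) - \<phi> (- 1) (X \<delta>) = \<delta> * A \<delta> + \<delta> * B \<delta>" "\<phi> (- 1) (X \<delta>) = V - \<delta> * B \<delta>"
      using elim(1) by (simp_all add: vals A_def B_def)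
    have ders: "pdx v (X \<delta> + c 1) (h 1) = p \<delta>" "pdx v (X \<delta> + c 0) (h 0) = q"
      "pdx v (X \<delta> + c (- 1)) (h (- 1)) = r \<delta>"
      "pdx (pdx v) (X \<delta> + c 1) (h 1) = p2 \<delta>" "pdx (pdx v) (X \<delta> + c 0) (h 0) = 2 * y2"
      "pdx (pdx v) (X \<delta> + c (- 1)) (h (- 1)) = r2 \<delta>"
      unfolding plus_pt minus_pt zero_pt p_def r_def p2_def r2_def plus_def minus_def q_def y2_def by simp_all
    have nz: "\<phi> 1 (X \<delta>) - \<phi> 0 (X \<delta>) \<noteq> 0" "\<phi> 0 (X \<delta>) - \<phi> (- 1) (X \<delta>) \<noteq> 0"
      unfolding diffs(1,2) using elim(1-3) by simp_all
    have PC: "P (1 / \<delta>) = C \<delta> / \<delta> ^ 3"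
      using P[OF elim(1)] by (simp add: C_def)
    note eqs = three_point_lhs_eq[where u = \<phi> and X = "X \<delta>"
        and d = "\<lambda>\<nu> x. pdx v (x + c \<nu>) (h \<nu>)"
        and e = "\<lambda>\<nu> x. pdx (pdx v) (x + c \<nu>) (h \<nu>)", OF d e nz]
    show ?case
      unfolding \<phi>_def[symmetric] eqs PC diffs(1-3) ders
      unfolding diffs(4)
      using three_point_scaled_difference[OF elim(1-3), where C = "C \<delta>" and ?b1.0 = b1 and ?b0.0 = b0
          and V = V and p = "p \<delta>" and q = q and r = "r \<delta>" and ?p2.0 = "p2 \<delta>" and ?q2.0 = "2 * y2"
          and ?r2.0 = "r2 \<delta>", folded S_def W_def, OF elim(4)] by simp
  qed
  with lim show ?thesis
    by (rule Lim_transform_eventually)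
qed

text \<open>With \<open>k\<close> equal to 0 or to g3(a), both forms of P(p) receive the shape C /
  \<delta>^3.\<close>

lemma g3_scaled:
  fixes \<delta> :: "'a::real_normed_field"
  assumes "\<delta> \<noteq> 0"
  shows "g3 \<alpha>0 \<alpha>1 \<alpha>2 (1 / \<delta>) - k =
    (1 + \<alpha>2 * \<delta> + \<alpha>1 * (\<delta> * \<delta>) + (\<alpha>0 - k) * (\<delta> * (\<delta> * \<delta>))) / \<delta> ^ 3"
  unfolding g3_def using assms by (simp add: divide_simps) (simp add: algebra_simps eval_nat_numeral)

theorem mainTheorem13:
  fixes v :: "'a::{real_normed_field, banach} \<Rightarrow> 'a \<Rightarrow> 'a"
    and U :: "('a \<times> 'a) set"
    and P :: "'a \<Rightarrow> 'a"
    and a b0 b1 \<alpha>0 \<alpha>1 \<alpha>2 \<xi> \<tau> :: 'a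
    and X Y :: "'a \<Rightarrow> 'a"
  assumes "open U" and "smooth_on2 U v" and "\<forall>(x, t)\<in>U. pdx v x t \<noteq> 0"
    and "P = g3 \<alpha>0 \<alpha>1 \<alpha>2 \<or> P = (\<lambda>p. g3 \<alpha>0 \<alpha>1 \<alpha>2 p - g3 \<alpha>0 \<alpha>1 \<alpha>2 a)"
    and "(\<xi>, \<tau>) \<in> U"
    and "\<forall>\<delta>. \<delta> \<noteq> 0 \<longrightarrow> new_x \<alpha>2 \<delta> (Y \<delta>) (X \<delta>) = \<xi> \<and> new_t \<delta> (Y \<delta>) = \<tau>"
  shows "((\<lambda>\<delta>. (three_point_lhs (P (1 / \<delta>)) b0 b1 (lattice_shift \<alpha>2 \<delta> v (Y \<delta>)) (X \<delta>)
                - three_point_rhs (lattice_shift \<alpha>2 \<delta> v (Y \<delta>)) (X \<delta>)) / \<delta> ^ 2)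
          \<longlongrightarrow> gen_sbsq b0 b1 v \<xi> \<tau> / 12) (at 0)
    \<and> ((\<exists>\<^sub>F \<delta> in at 0.
            three_point_lhs (P (1 / \<delta>)) b0 b1 (lattice_shift \<alpha>2 \<delta> v (Y \<delta>)) (X \<delta>)
            = three_point_rhs (lattice_shift \<alpha>2 \<delta> v (Y \<delta>)) (X \<delta>))
          \<longrightarrow> gen_sbsq b0 b1 v \<xi> \<tau> = 0)
    \<and> gen_sbsq (0::'a) 0 = sbsq
    \<and> mobius_invariant (sbsq :: ('a \<Rightarrow> 'a \<Rightarrow> 'a) \<Rightarrow> 'a \<Rightarrow> 'a \<Rightarrow> 'a)
    \<and> (b0 \<noteq> 0 \<or> b1 \<noteq> 0 \<longrightarrow> \<not> mobius_invariant (gen_sbsq b0 b1))"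
proof (intro conjI impI)
  obtain k where k: "P = (\<lambda>p. g3 \<alpha>0 \<alpha>1 \<alpha>2 p - k)"
    using assms(4) by (metis (no_types, lifting) diff_zero ext)
  let ?L = "\<lambda>\<delta>. three_point_lhs (P (1 / \<delta>)) b0 b1 (lattice_shift \<alpha>2 \<delta> v (Y \<delta>)) (X \<delta>)"
    and ?R = "\<lambda>\<delta>. three_point_rhs (lattice_shift \<alpha>2 \<delta> v (Y \<delta>)) (X \<delta>)"
  show lim: "((\<lambda>\<delta>. (?L \<delta> - ?R \<delta>) / \<delta> ^ 2) \<longlongrightarrow> gen_sbsq b0 b1 v \<xi> \<tau> / 12) (at 0)"
  proof (rule three_point_limit[OF assms(1,5,2)])
    show "P (1 / \<delta>) = (1 + \<alpha>2 * \<delta> + \<alpha>1 * (\<delta> * \<delta>) + (\<alpha>0 - k) * (\<delta> * (\<delta> * \<delta>))) / \<delta> ^ 3"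
      if "\<delta> \<noteq> 0" for \<delta>
      unfolding k by (rule g3_scaled[OF that])
  qed (use assms(3,6) in auto)
  show "gen_sbsq b0 b1 v \<xi> \<tau> = 0" if eq: "\<exists>\<^sub>F \<delta> in at 0. ?L \<delta> = ?R \<delta>"
  proof (rule ccontr)
    assume "gen_sbsq b0 b1 v \<xi> \<tau> \<noteq> 0"
    then have "gen_sbsq b0 b1 v \<xi> \<tau> / 12 \<noteq> 0" by simp
    \<comment> \<open>A nonzero limit would keep the two sides apart for every small \<delta>
      \<noteq> 0, whereas they agree for some \<delta> \<noteq> 0 arbitrarily close to 0.\<close>
    from tendsto_imp_eventually_ne[OF lim this]
    have "\<forall>\<^sub>F \<delta> in at 0. ?L \<delta> \<noteq> ?R \<delta>"
      by (rule eventually_mono) auto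
    with eq show False by (simp add: frequently_def)
  qed
  show "gen_sbsq (0::'a) 0 = sbsq" by (rule gen_sbsq_0_0)
  show "mobius_invariant (sbsq :: ('a \<Rightarrow> 'a \<Rightarrow> 'a) \<Rightarrow> 'a \<Rightarrow> 'a \<Rightarrow> 'a)"
    by (rule mobius_invariant_sbsq)
  show "\<not> mobius_invariant (gen_sbsq b0 b1)" if "b0 \<noteq> 0 \<or> b1 \<noteq> 0"
    using that by (rule not_mobius_invariant_gen_sbsq)
qed

end
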